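(* Let $W$ be an $n\times n$ matrix weight on $\mathbb{R}^d$ with $W\in \mathrm{A}_1$, and let $$M_W f(x)=\sup_{Q\ni x}\frac{1}{|Q|}\int_Q |W(x)W^{-1}(y)f(y)|\,dy .$$ Then there is a constant $C$, depending only on $n$ and $d$ (and not on $W$), such that for all $f\in L^1(\mathbb{R}^d,\mathbb{C}^n)$ and all $\lambda>0$, $$|\{x\in\mathbb{R}^d: M_Wf(x)>\lambda\}|\le C\,\frac{[W]_{\mathrm{A}_1}[W]_{\mathrm{A}_\infty^{\mathrm{sc}}}}{\lambda}\int_{\mathbb{R}^d}|f(x)|\,dx .$$
   Context: Cubes $Q\subset\mathbb{R}^d$ have sides parallel to the coordinate axes. A matrix weight $W$ is a self-adjoint $n\times n$ matrix-valued function on $\mathbb{R}^d$ with locally integrable entries such that $W(x)$ is positive definite for a.e. $x$. $|A|_{\mathrm{op}}=\sup_{e\in\mathbb{C}^n,|e|=1}|Ae|$ is the operator norm. $W\in\mathrm{A}_1$ means $$[W]_{\mathrm{A}_1}=\operatorname*{ess\,sup}_{x\in\mathbb{R}^d}\ \sup_{Q\ni x}\frac{1}{|Q|}\int_Q|W(y)W^{-1}(x)|_{\mathrm{op}}\,dy<\infty .$$ The scalar $A_\infty$ constant of $W$ is $[W]_{\mathrm{A}_\infty^{\mathrm{sc}}}=\sup_{e\in\mathbb{C}^n\setminus\{0\}}[\,|W(\cdot)e|\,]_{A_\infty}$, where for a scalar weight $w$ the (Fujii-Wilson) constant is $[w]_{A_\infty}=\sup_Q\frac{1}{\int_Q w}\int_Q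 M(w\chi_Q)(x)\,dx$, with $M$ the Hardy-Littlewood maximal operator over cubes. *)

theory Defs
  imports "HOL-Analysis.Analysis" "HOL-Probability.Essential_Supremum"
begin

text \<open>Points of the domain are \<open>real ^ 'd\<close> and vectors are \<open>complex ^ 'n\<close>, both with the
  Euclidean norm. Averages, maximal functions and weight constants take values in \<open>ennreal\<close>,
  so that no finiteness is built in.\<close>

text \<open>Cubes are nondegenerate and closed.\<close>

definition cube :: "(real ^ 'd) set \<Rightarrow> bool" where
  "cube Q \<longleftrightarrow> (\<exists>a l. 0 < l \<and> Q = cbox a (\<chi> i. a $ i + l))"

definition avg :: "(real ^ 'd) set \<Rightarrow> (real ^ 'd \<Rightarrow> ennreal) \<Rightarrow> ennreal" where
  "avg Q g = (\<integral>\<^sup>+ y\<in>Q. g y \<partial>lebesgue) / emeasure lebesgue Q"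

definition locally_integrable :: "(real ^ 'd \<Rightarrow> complex) \<Rightarrow> bool" where
  "locally_integrable g \<longleftrightarrow> (\<forall>K. compact K \<longrightarrow> set_integrable lebesgue K g)"

definition self_adjoint :: "complex ^ 'n ^ 'n \<Rightarrow> bool" where
  "self_adjoint A \<longleftrightarrow> (\<forall>i j. A $ i $ j = cnj (A $ j $ i))"

text \<open>For self-adjoint \<open>A\<close> the Hermitian form below is real, so taking its real part loses
  nothing.\<close>

definition positive_definite :: "complex ^ 'n ^ 'n \<Rightarrow> bool" where
  "positive_definite A \<longleftrightarrow>
     self_adjoint A \<and> (\<forall>e. e \<noteq> 0 \<longrightarrow> 0 < Re (\<Sum>i\<in>UNIV. (A *v e) $ i * cnj (e $ i)))"

definition matrix_weight :: "(real ^ 'd \<Rightarrow> complex ^ 'n ^ 'n) \<Rightarrow> bool" where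
  "matrix_weight W \<longleftrightarrow>
     (\<forall>x. self_adjoint (W x)) \<and>
     (\<forall>i j. locally_integrable (\<lambda>x. W x $ i $ j)) \<and>
     (AE x in lebesgue. positive_definite (W x))"

text \<open>On the null set where \<open>W x\<close> is singular, \<open>matrix_inv (W x)\<close> is unspecified. This affects
  neither the integrals nor the essential supremum below.\<close>

definition A1_const :: "(real ^ 'd \<Rightarrow> complex ^ 'n ^ 'n) \<Rightarrow> ennreal" where
  "A1_const W = esssup lebesgue (\<lambda>x. SUP Q\<in>{Q. cube Q \<and> x \<in> Q}.
     avg Q (\<lambda>y. ennreal (onorm (\<lambda>e. (W y ** matrix_inv (W x)) *v e))))"

definition hl_maximal :: "(real ^ 'd \<Rightarrow> real) \<Rightarrow> real ^ 'd \<Rightarrow> ennreal" where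
  "hl_maximal g x = (SUP Q\<in>{Q. cube Q \<and> x \<in> Q}. avg Q (\<lambda>y. ennreal \<bar>g y\<bar>))"

text \<open>The Fujii--Wilson constant of a scalar weight.\<close>

definition Ainfty_const :: "(real ^ 'd \<Rightarrow> real) \<Rightarrow> ennreal" where
  "Ainfty_const w = (SUP Q\<in>{Q. cube Q}.
     (\<integral>\<^sup>+ x\<in>Q. hl_maximal (\<lambda>y. w y * indicator Q y) x \<partial>lebesgue) /
     (\<integral>\<^sup>+ y\<in>Q. ennreal (w y) \<partial>lebesgue))"

definition Ainfty_sc_const :: "(real ^ 'd \<Rightarrow> complex ^ 'n ^ 'n) \<Rightarrow> ennreal" where
  "Ainfty_sc_const W = (SUP e\<in>{e. e \<noteq> 0}. Ainfty_const (\<lambda>x. norm (W x *v e)))"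

definition weighted_maximal ::
  "(real ^ 'd \<Rightarrow> complex ^ 'n ^ 'n) \<Rightarrow> (real ^ 'd \<Rightarrow> complex ^ 'n) \<Rightarrow> real ^ 'd \<Rightarrow> ennreal" where
  "weighted_maximal W f x = (SUP Q\<in>{Q. cube Q \<and> x \<in> Q}.
     avg Q (\<lambda>y. ennreal (norm ((W x ** matrix_inv (W y)) *v f y))))"

end

theory Submission
  imports Defs
begin

text \<open>For a cube \<open>Q\<close> let \<open>\<rho>\<close> be the norm \<open>e \<mapsto> avg Q |W e|\<close> and let \<open>E i\<close> be an Auerbach basis for it, so that
  \<open>|A x| \<le> \<rho> x * (\<Sum>i. |A (E i)|)\<close> for every matrix \<open>A\<close>. The A1 condition says \<open>\<rho> (W\<^sup>-\<^sup>1(y) v) \<le> [W] |v|\<close> for almost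
  every \<open>y\<close> in \<open>Q\<close>, hence \<open>|W(x) W\<^sup>-\<^sup>1(y) v| \<le> [W] |v| (\<Sum>i. |W(x) (E i)|)\<close> for \<open>x, y\<close> in \<open>Q\<close>.

  Sort the cubes \<open>P\<close> by the size of \<open>avg P |f|\<close> in powers of two and apply Vitali's covering lemma in each
  class: every cube of the class lies in the five-fold enlargement \<open>Q\<close> of a selected one, and the
  selected cubes are disjoint, hence of small total measure. By the previous estimate, used on
  \<open>Q\<close>, the superlevel set is contained in the union of the sets \<open>{x \<in> Q. |W(x) (E i)| > 2^m}\<close>.

  The scalar weights \<open>w = |W (E i)|\<close> satisfy the Fujii--Wilson condition. On a cube \<open>Q\<close>, a
  Vitali selection at each level \<open>2^m avg Q w\<close> with \<open>m \<le> N\<close>, combined with the bound on the integral of the maximal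
  function and the pigeonhole principle, produces one level at which the selected cubes carry a small part of the
  mass of \<open>w\<close>; iterating inside the selected cubes shows that the mass of \<open>w > 2^(jN) avg Q w\<close>
  is at most \<open>2^-j\<close> times that of \<open>Q\<close>. Summing over \<open>m\<close> then loses only a factor comparable to \<open>N\<close>.\<close>

subsection \<open>Vitali selection and Auerbach bases\<close>

text \<open>Zorn's lemma on disjoint families \<open>J\<close> such that every index meeting
  \<open>J\<close> meets a member at least half as large; asking this only of indices that meet
  \<open>J\<close> makes it pass to unions of chains. If a maximal family missed some index, a
  missed index of nearly maximal size could be added.\<close>

lemma vitali_selection:
  fixes S :: "'i \<Rightarrow> 'a set" and s :: "'i \<Rightarrow> real"
  assumes s: "\<And>i. i \<in> I \<Longrightarrow> 0 < s i \<and> s i \<le> R" and ne: "\<And>i. i \<in> I \<Longrightarrow> S i \<noteq> {}"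
  obtains J where "J \<subseteq> I" "pairwise (\<lambda>i j. disjnt (S i) (S j)) J"
    "\<And>i. i \<in> I \<Longrightarrow> \<exists>j\<in>J. \<not> disjnt (S i) (S j) \<and> s i \<le> 2 * s j"
proof -
  define \<A> where "\<A> = {J. J \<subseteq> I \<and> pairwise (\<lambda>i j. disjnt (S i) (S j)) J \<and>
    (\<forall>i\<in>I. (\<exists>j\<in>J. \<not> disjnt (S i) (S j)) \<longrightarrow> (\<exists>j\<in>J. \<not> disjnt (S i) (S j) \<and> s i \<le> 2 * s j))}"
  have "\<exists>M\<in>\<A>. \<forall>X\<in>\<A>. M \<subseteq> X \<longrightarrow> X = M"
  proof (rule subset_Zorn')
    fix C assume C: "subset.chain \<A> C"
    then have CA: "C \<subseteq> \<A>" and tot: "\<And>X Y. X \<in> C \<Longrightarrow> Y \<in> C \<Longrightarrow> X \<subseteq> Y \<or> Y \<subseteq> X"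
      by (auto simp: subset_chain_def)
    have "pairwise (\<lambda>i j. disjnt (S i) (S j)) (\<Union>C)"
    proof (rule pairwiseI)
      fix x y assume "x \<in> \<Union>C" "y \<in> \<Union>C" "x \<noteq> y"
      then obtain X Y where XY: "X \<in> C" "Y \<in> C" "x \<in> X" "y \<in> Y" by blast
      then obtain Z where "Z \<in> C" "x \<in> Z" "y \<in> Z" using tot by blast
      then show "disjnt (S x) (S y)"
        using CA \<open>x \<noteq> y\<close> unfolding \<A>_def pairwise_def by blast
    qed
    moreover have "\<Union>C \<subseteq> I" using CA by (auto simp: \<A>_def)
    moreover have "\<exists>j\<in>\<Union>C. \<not> disjnt (S i) (S j) \<and> s i \<le> 2 * s j"
      if i: "i \<in> I" and jC: "j \<in> \<Union>C" and nd: "\<not> disjnt (S i) (S j)" for i j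
    proof -
      obtain X where X: "X \<in> C" "j \<in> X" using jC by blast
      then have "X \<in> \<A>" using CA by blast
      then have "\<exists>j\<in>X. \<not> disjnt (S i) (S j) \<and> s i \<le> 2 * s j"
        using i X(2) nd unfolding \<A>_def by blast
      then show ?thesis using X by blast
    qed
    ultimately show "\<Union>C \<in> \<A>" unfolding \<A>_def by blast
  qed
  then obtain M where M: "M \<in> \<A>" and max: "\<And>X. X \<in> \<A> \<Longrightarrow> M \<subseteq> X \<Longrightarrow> X = M" by blast
  have MI: "M \<subseteq> I" and Mp: "pairwise (\<lambda>i j. disjnt (S i) (S j)) M"
    and Mc: "\<And>i j. i \<in> I \<Longrightarrow> j \<in> M \<Longrightarrow> \<not> disjnt (S i) (S j) \<Longrightarrow>
       \<exists>j\<in>M. \<not> disjnt (S i) (S j) \<and> s i \<le> 2 * s j"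
    using M unfolding \<A>_def by blast+
  define K where "K = {i\<in>I. \<forall>j\<in>M. disjnt (S i) (S j)}"
  have "K = {}"
  proof (rule ccontr)
    assume "K \<noteq> {}"
    have bdd: "bdd_above (s ` K)" using s by (auto simp: K_def bdd_above_def)
    obtain i0 where "i0 \<in> K" using \<open>K \<noteq> {}\<close> by blast
    then have "0 < Sup (s ` K)"
      using s[of i0] cSUP_upper[OF _ bdd, of i0] by (auto simp: K_def)
    then have "Sup (s ` K) / 2 < Sup (s ` K)" by simp
    then obtain p where p: "p \<in> K" "Sup (s ` K) / 2 < s p"
      using less_cSUP_iff[OF \<open>K \<noteq> {}\<close> bdd] by blast
    have le: "s i \<le> 2 * s p" if "i \<in> K" for i
      using cSUP_upper[OF that bdd] p(2) by linarith
    have pI: "p \<in> I" and pd: "\<And>j. j \<in> M \<Longrightarrow> disjnt (S p) (S j)" using p(1) by (auto simp: K_def)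
    have "insert p M \<in> \<A>"
      unfolding \<A>_def
    proof (intro CollectI conjI ballI impI)
      show "insert p M \<subseteq> I" using MI pI by blast
      show "pairwise (\<lambda>i j. disjnt (S i) (S j)) (insert p M)"
        using Mp pd by (auto simp: pairwise_insert disjnt_sym)
      fix i assume i: "i \<in> I" and ex: "\<exists>j\<in>insert p M. \<not> disjnt (S i) (S j)"
      show "\<exists>j\<in>insert p M. \<not> disjnt (S i) (S j) \<and> s i \<le> 2 * s j"
      proof (cases "i \<in> K")
        case True
        then have "\<not> disjnt (S i) (S p)" using ex by (auto simp: K_def)
        then show ?thesis using le[OF True] by blast
      next
        case False
        then obtain j where "j \<in> M" "\<not> disjnt (S i) (S j)" using i by (auto simp: K_def)
        then show ?thesis using Mc[OF i] by blast
      qed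
    qed
    then have "p \<in> M" using max[of "insert p M"] by blast
    then show False using pd[of p] ne[OF pI] by (simp add: disjnt_def)
  qed
  then have "\<exists>j\<in>M. \<not> disjnt (S i) (S j) \<and> s i \<le> 2 * s j" if "i \<in> I" for i
    using Mc[OF that] that unfolding K_def by blast
  then show ?thesis using that[OF MI Mp] by blast
qed

section \<open>Linear algebra for Auerbach bases\<close>

lemma matrix_inv_right:
  fixes A :: "'a::semiring_1 ^ 'n ^ 'm"
  assumes "invertible A"
  shows "A ** matrix_inv A = mat 1"
  using assms someI_ex[of "\<lambda>A'. A ** A' = mat 1 \<and> A' ** A = mat 1"]
  unfolding invertible_def matrix_inv_def by blast

lemma norm_smult_vec: "norm (c *s x) = norm c * norm x" for x :: "complex ^ 'n"
  unfolding norm_vec_def by (simp add: norm_mult L2_set_right_distrib)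

text \<open>An Auerbach basis: unit vectors maximising the determinant. By Cramer's rule the coordinates
  of \<open>x\<close> with respect to \<open>E\<close> are then at most \<open>\<rho> x\<close>.\<close>

lemma norm_basis_exists:
  fixes \<rho> :: "complex ^ 'n \<Rightarrow> real"
  assumes nn: "\<And>x. 0 \<le> \<rho> x" and tri: "\<And>x y. \<rho> (x + y) \<le> \<rho> x + \<rho> y"
    and hom: "\<And>c x. \<rho> (c *s x) = norm c * \<rho> x" and pos: "\<And>x. x \<noteq> 0 \<Longrightarrow> 0 < \<rho> x"
  obtains E :: "'n \<Rightarrow> complex ^ 'n"
  where "\<And>i. \<rho> (E i) \<le> 1" "\<And>i. E i \<noteq> 0"
    "\<And>A x. norm (A *v x) \<le> \<rho> x * (\<Sum>i\<in>UNIV. norm ((A :: complex ^ 'n ^ 'n) *v E i))"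
proof -
  define K where "K = (\<Sum>i\<in>UNIV. \<rho> (axis i 1))"
  have \<rho>0: "\<rho> 0 = 0" using hom[of 0 0] by simp
  have K: "\<rho> x \<le> K * norm x" for x
  proof -
    have sum: "\<rho> (\<Sum>i\<in>I. g i) \<le> (\<Sum>i\<in>I. \<rho> (g i))" if "finite I" for I :: "'n set" and g
      using that by (induction I) (auto simp: \<rho>0 intro: order_trans[OF tri])
    have "x = (\<Sum>i\<in>UNIV. x $ i *s axis i 1)" by (simp add: basis_expansion)
    then have "\<rho> x \<le> (\<Sum>i\<in>UNIV. \<rho> (x $ i *s axis i 1))" using sum[of UNIV] by (metis finite)
    also have "\<dots> \<le> (\<Sum>i\<in>UNIV. norm x * \<rho> (axis i 1))"
      unfolding hom by (intro sum_mono mult_right_mono nn component_le_norm_cart Finite_Cartesian_Product.norm_nth_le)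
    finally show ?thesis by (simp add: K_def sum_distrib_left mult.commute)
  qed
  have Kpos: "0 \<le> K" unfolding K_def by (intro sum_nonneg nn)
  have neg: "\<rho> (- x) = \<rho> x" for x using hom[of "-1" x] by (simp add: vector_sneg_minus1[symmetric])
  have diff: "\<bar>\<rho> x - \<rho> y\<bar> \<le> K * norm (x - y)" for x y
  proof -
    have "\<rho> x \<le> \<rho> y + \<rho> (x - y)" using tri[of y "x - y"] by simp
    moreover have "\<rho> y \<le> \<rho> x + \<rho> (x - y)" using tri[of x "y - x"] neg[of "x - y"] by simp
    ultimately show ?thesis using K[of "x - y"] by linarith
  qed
  have cont: "continuous_on UNIV \<rho>"
  proof -
    have "K-lipschitz_on UNIV \<rho>"
      using diff Kpos by (intro lipschitz_onI) (auto simp: dist_norm)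
    then show ?thesis by (rule lipschitz_on_continuous_on)
  qed
  have scaleR_eq: "r *\<^sub>R x = complex_of_real r *s x" for r and x :: "complex ^ 'n"
    unfolding vec_eq_iff vector_scaleR_component vector_smult_component by (simp add: scaleR_conv_of_real)
  \<comment> \<open>The minimum of \<open>\<rho>\<close> on the Euclidean unit sphere is positive by
    compactness; this is what makes \<open>B\<close> below bounded.\<close>
  obtain c where c: "0 < c" "\<And>x. c * norm x \<le> \<rho> x"
  proof -
    have "compact (sphere (0 :: complex ^ 'n) 1)" "sphere (0 :: complex ^ 'n) 1 \<noteq> {}" by auto
    then obtain u where u: "u \<in> sphere 0 1" "\<And>y. y \<in> sphere 0 1 \<Longrightarrow> \<rho> u \<le> \<rho> y"
      using continuous_attains_inf[of "sphere 0 1" \<rho>] cont continuous_on_subset by blast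
    have "\<rho> u * norm x \<le> \<rho> x" for x
    proof (cases "x = 0")
      case False
      have "\<rho> u \<le> \<rho> (inverse (norm x) *\<^sub>R x)" using u(2) False by simp
      also have "\<dots> = inverse (norm x) * \<rho> x" unfolding scaleR_eq hom norm_of_real by simp
      finally show ?thesis using False by (simp add: field_simps)
    qed (simp add: \<rho>0)
    moreover have "0 < \<rho> u" using u(1) by (intro pos) auto
    ultimately show ?thesis using that by blast
  qed
  define B where "B = {M :: complex ^ 'n ^ 'n. \<forall>i. \<rho> (M $ i) \<le> 1}"
  have "closed B"
  proof -
    have "closed {M :: complex ^ 'n ^ 'n. \<rho> (M $ i) \<le> 1}" for i
      by (intro closed_Collect_le continuous_on_compose2[OF cont] continuous_intros) auto
    then show ?thesis unfolding B_def by (intro closed_Collect_all)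
  qed
  moreover have "bounded B"
  proof (rule boundedI)
    fix M assume "M \<in> B"
    then have *: "norm (M $ i) \<le> 1 / c" for i
      using c(2)[of "M $ i"] c(1) by (auto simp: B_def field_simps intro: order_trans)
    have "norm M \<le> (\<Sum>i\<in>UNIV. norm (M $ i))"
      unfolding norm_vec_def by (rule L2_set_le_sum) simp
    also have "\<dots> \<le> (\<Sum>i\<in>(UNIV :: 'n set). 1 / c)" by (intro sum_mono *)
    finally show "norm M \<le> (\<Sum>i\<in>(UNIV :: 'n set). 1 / c)" .
  qed
  ultimately have cB: "compact B" by (simp add: compact_eq_bounded_closed)
  have "0 \<in> B" by (simp add: B_def \<rho>0)
  moreover have "continuous_on B (\<lambda>M. norm (det M))"
    unfolding det_def by (intro continuous_intros)
  ultimately obtain M where M: "M \<in> B" and max: "\<And>X. X \<in> B \<Longrightarrow> norm (det X) \<le> norm (det M)"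
    using continuous_attains_sup[OF cB] by blast
  have "det M \<noteq> 0"
  proof -
    \<comment> \<open>A small multiple of the identity lies in \<open>B\<close>, so the maximal
      determinant is not zero. Dividing by \<open>1 + K\<close> asks no more of \<open>K\<close>
      than \<open>0 \<le> K\<close>.\<close>
    define X :: "complex ^ 'n ^ 'n" where "X = (\<chi> i. complex_of_real (1 / (1 + K)) *s axis i 1)"
    have "\<rho> (X $ i) \<le> 1" for i
    proof -
      have "\<rho> (X $ i) = \<bar>1 / (1 + K)\<bar> * \<rho> (axis i 1)" 
        by (simp only: X_def vec_lambda_beta hom norm_of_real real_norm_def)
      also have "\<dots> \<le> 1 / (1 + K) * K" using K[of "axis i 1"] Kpos
        by (intro mult_mono nn) auto
      also have "\<dots> \<le> 1" using Kpos by (simp add: field_simps)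
      finally show ?thesis .
    qed
    then have "X \<in> B" by (simp add: B_def)
    moreover have "det X = (\<Prod>i\<in>UNIV. X $ i $ i)"
      by (rule det_diagonal) (auto simp: X_def axis_def)
    then have "det X \<noteq> 0" using Kpos by (auto simp: X_def axis_def add_nonneg_eq_0_iff)
       (metis add_nonneg_eq_0_iff of_real_1 of_real_add of_real_eq_0_iff zero_le_one zero_neq_one)
    ultimately show ?thesis using max[of X] by auto
  qed
  define E where "E i = M $ i" for i
  have E1: "\<rho> (E i) \<le> 1" for i using M by (simp add: B_def E_def)
  moreover have "E i \<noteq> 0" for i
    using \<open>det M \<noteq> 0\<close> det_zero_row[of i M] by (auto simp: E_def row_def vec_eq_iff)
  moreover have "norm (A *v x) \<le> \<rho> x * (\<Sum>i\<in>UNIV. norm (A *v E i))" for A x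
  proof -
    define y where "y = matrix_inv (transpose M) *v x"
    have inv: "invertible (transpose M)" using \<open>det M \<noteq> 0\<close> by (simp add: invertible_det_nz)
    then have y: "x = (\<Sum>i\<in>UNIV. y $ i *s E i)"
    proof -
      have "x = transpose M *v y"
        unfolding y_def by (simp add: matrix_vector_mul_assoc matrix_inv_right[OF inv])
      then show ?thesis
        by (simp add: matrix_vector_mult_def transpose_def vec_eq_iff E_def mult.commute)
    qed
    have yk: "norm (y $ k) \<le> \<rho> x" for k
    proof (cases "x = 0")
      case True
      then show ?thesis by (simp add: y_def \<rho>0)
    next
      case False
      \<comment> \<open>Replacing row \<open>k\<close> of \<open>M\<close> by the normalised
        \<open>x\<close> stays in \<open>B\<close> and, by Cramer's rule, multiplies the determinant
        by \<open>y $ k / \<rho> x\<close>. Maximality of \<open>M\<close> bounds this factor by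
        one.\<close>
      define u where "u = complex_of_real (inverse (\<rho> x)) *s x"
      define X :: "complex ^ 'n ^ 'n" where "X = (\<chi> i. if i = k then u else row i M)"
      have "\<rho> u = 1" using pos[OF False] unfolding u_def hom by (simp add: norm_inverse)
      then have "X \<in> B" using E1 by (auto simp: B_def X_def row_def E_def)
      have "det X = complex_of_real (inverse (\<rho> x)) * det (\<chi> i. if i = k then x else row i M)"
        unfolding X_def u_def by (rule det_row_mul)
      also have "x = (\<Sum>i\<in>UNIV. y $ i *s row i M)" using y by (simp add: E_def row_def)
      then have "det (\<chi> i. if i = k then x else row i M) = y $ k * det M"
        using cramer_lemma_transpose[of k y M] by metis
      finally have "norm (det X) = norm (y $ k) / \<rho> x * norm (det M)"
        using pos[OF False] by (simp only: norm_mult norm_of_real) (simp add: divide_simps)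
      then have "norm (y $ k) / \<rho> x * norm (det M) \<le> 1 * norm (det M)"
        using max[OF \<open>X \<in> B\<close>] by simp
      then have "norm (y $ k) / \<rho> x \<le> 1" using \<open>det M \<noteq> 0\<close> by (subst (asm) mult_le_cancel_right) auto
      then show ?thesis using pos[OF False] by (simp add: field_simps)
    qed
    have "A *v x = (\<Sum>i\<in>UNIV. y $ i *s (A *v E i))"
      by (subst y) (simp add: vec.linear_sum[OF matrix_vector_mul_linear_gen] vec.linear_scale[OF matrix_vector_mul_linear_gen])
    then have "norm (A *v x) \<le> (\<Sum>i\<in>UNIV. norm (y $ i *s (A *v E i)))" by (simp add: norm_sum)
    also have "\<dots> = (\<Sum>i\<in>UNIV. norm (y $ i) * norm (A *v E i))"
      by (simp add: norm_smult_vec)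
    also have "\<dots> \<le> (\<Sum>i\<in>UNIV. \<rho> x * norm (A *v E i))" by (intro sum_mono mult_right_mono yk) simp
    finally show ?thesis by (simp add: sum_distrib_left)
  qed
  ultimately show ?thesis using that by blast
qed

subsection \<open>Cubes\<close>

definition cub :: "real ^ 'd \<Rightarrow> real \<Rightarrow> (real ^ 'd) set" where
  "cub a r = cbox a (\<chi> i. a $ i + r)"

lemma mem_cub: "x \<in> cub a r \<longleftrightarrow> (\<forall>i. a $ i \<le> x $ i \<and> x $ i \<le> a $ i + r)"
  by (simp add: cub_def mem_box_cart)

lemma cube_iff_cub: "cube Q \<longleftrightarrow> (\<exists>a r. 0 < r \<and> Q = cub a r)"
  by (simp add: cube_def cub_def)

lemma cube_cub: "0 < r \<Longrightarrow> cube (cub a r)"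
  by (auto simp: cube_iff_cub)

lemma sets_cub [measurable, simp]: "cub a r \<in> sets lebesgue"
  by (simp add: cub_def)

lemma corner_in_cub: "0 \<le> r \<Longrightarrow> a \<in> cub a r"
  by (simp add: mem_cub)

lemma emeasure_cub:
  fixes a :: "real ^ 'd"
  assumes "0 \<le> r"
  shows "emeasure lebesgue (cub a r) = ennreal (r ^ CARD('d))"
proof -
  have "cub a r \<noteq> {}" using corner_in_cub[OF assms] by blast
  then have "measure lborel (cub a r) = r ^ CARD('d)"
    unfolding cub_def by (subst content_cbox_cart) auto
  moreover have "emeasure lborel (cub a r) \<noteq> \<infinity>"
    unfolding cub_def using emeasure_lborel_cbox_finite[of a "\<chi> i. a $ i + r"] by simp
  ultimately have "emeasure lborel (cub a r) = ennreal (r ^ CARD('d))"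
    by (metis emeasure_eq_ennreal_measure infinity_ennreal_def)
  then show ?thesis by (simp add: cub_def)
qed

lemma cub_subset_iff:
  assumes "0 \<le> r"
  shows "cub a r \<subseteq> cub b s \<longleftrightarrow> (\<forall>i. b $ i \<le> a $ i \<and> a $ i + r \<le> b $ i + s)"
proof
  assume sub: "cub a r \<subseteq> cub b s"
  have "a \<in> cub a r" "(\<chi> i. a $ i + r) \<in> cub a r" using assms by (auto simp: mem_cub)
  then have "a \<in> cub b s" "(\<chi> i. a $ i + r) \<in> cub b s" using sub by blast+
  then show "\<forall>i. b $ i \<le> a $ i \<and> a $ i + r \<le> b $ i + s" by (auto simp: mem_cub)
next
  assume "\<forall>i. b $ i \<le> a $ i \<and> a $ i + r \<le> b $ i + s"
  then have "b $ i \<le> x $ i \<and> x $ i \<le> b $ i + s" if "x \<in> cub a r" for x i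
    using that unfolding mem_cub by (meson order_trans)
  then show "cub a r \<subseteq> cub b s" by (auto simp: mem_cub)
qed

text \<open>Disjoint nonempty sets are distinct, so \<open>J\<close> is in bijection with its cubes,
  and disjoint sets with nonempty interior form a countable family.\<close>

lemma vitali_cubes:
  fixes I :: "((real ^ 'd) \<times> real) set"
  assumes "\<And>a r. (a, r) \<in> I \<Longrightarrow> 0 < r \<and> r \<le> R"
  obtains J where "J \<subseteq> I" "countable J" "disjoint_family_on (\<lambda>(a, r). cub a r) J"
    "\<And>a r. (a, r) \<in> I \<Longrightarrow> \<exists>(b, s)\<in>J. \<not> disjnt (cub a r) (cub b s) \<and> r \<le> 2 * s"
proof -
  let ?S = "\<lambda>p :: (real ^ 'd) \<times> real. cub (fst p) (snd p)"
  have I: "0 < snd p \<and> snd p \<le> R" if "p \<in> I" for p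
    using assms[of "fst p" "snd p"] that by simp
  have ne: "?S p \<noteq> {}" if "p \<in> I" for p
  proof -
    have "0 \<le> snd p" using I[OF that] by simp
    then show ?thesis using corner_in_cub by blast
  qed
  obtain J where J: "J \<subseteq> I" "pairwise (\<lambda>i j. disjnt (?S i) (?S j)) J"
    "\<And>i. i \<in> I \<Longrightarrow> \<exists>j\<in>J. \<not> disjnt (?S i) (?S j) \<and> snd i \<le> 2 * snd j"
    by (rule vitali_selection[of I snd R ?S]; (rule I ne that; assumption))
  have "inj_on ?S J"
  proof (rule inj_onI, rule ccontr)
    fix p q assume pq: "p \<in> J" "q \<in> J" "?S p = ?S q" "p \<noteq> q"
    then have "disjnt (?S p) (?S p)" using pairwiseD[OF J(2), of p q] by simp
    then show False using ne J(1) pq(1) by (auto simp: disjnt_def)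
  qed
  moreover have "countable (?S ` J)"
  proof (rule countable_disjoint_nonempty_interior_subsets)
    show "disjoint (?S ` J)" using J(2) by (auto intro: pairwise_imageI dest: pairwiseD)
    fix S assume "S \<in> ?S ` J" "interior S = {}"
    then obtain p where p: "p \<in> J" "interior (cub (fst p) (snd p)) = {}" by blast
    then have "0 < snd p" using I J(1) by blast
    then have "fst p + (\<chi> i. snd p / 2) \<in> interior (cub (fst p) (snd p))"
      unfolding cub_def interior_cbox by (auto simp: mem_box_cart)
    then show "S = {}" using p(2) by blast
  qed
  ultimately have "countable J" using countable_image_inj_on by blast
  moreover have "disjoint_family_on (\<lambda>(a, r). cub a r) J"
    using J(2) by (auto simp: disjoint_family_on_def pairwise_def disjnt_def case_prod_beta)
  moreover have "\<exists>(b, s)\<in>J. \<not> disjnt (cub a r) (cub b s) \<and> r \<le> 2 * s" if "(a, r) \<in> I" for a r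
    using J(3)[OF that] by (auto simp: case_prod_beta)
  ultimately show ?thesis using that J(1) by blast
qed

text \<open>Since the cubes meet, \<open>cub a r\<close> overhangs \<open>cub b s\<close> by at most
  \<open>r \<le> 2 * s\<close> on either side, whence the side
  \<open>2 * s + s + 2 * s\<close>.\<close>

lemma cub_subset_enlarged:
  fixes a b :: "real ^ 'd"
  assumes "\<not> disjnt (cub a r) (cub b s)" "r \<le> 2 * s"
  shows "cub a r \<subseteq> cub (\<chi> i. b $ i - 2 * s) (5 * s)"
proof -
  obtain z where z: "z \<in> cub a r" "z \<in> cub b s" using assms(1) by (auto simp: disjnt_def)
  show ?thesis
  proof
    fix x assume x: "x \<in> cub a r"
    have "b $ i - 2 * s \<le> x $ i \<and> x $ i \<le> b $ i - 2 * s + 5 * s" for i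
    proof -
      have "a $ i \<le> x $ i" "x $ i \<le> a $ i + r" "a $ i \<le> z $ i" "z $ i \<le> a $ i + r"
        "b $ i \<le> z $ i" "z $ i \<le> b $ i + s"
        using x z by (auto simp: mem_cub)
      then show ?thesis using assms(2) by linarith
    qed
    then show "x \<in> cub (\<chi> i. b $ i - 2 * s) (5 * s)" by (simp add: mem_cub)
  qed
qed

text \<open>The five-fold enlargement of \<open>cub b s\<close>, shifted so that it stays inside \<open>cub c L\<close>.\<close>

definition shifted_corner :: "real ^ 'd \<Rightarrow> real \<Rightarrow> real ^ 'd \<Rightarrow> real \<Rightarrow> real ^ 'd" where
  "shifted_corner c L b s = (\<chi> i. max (c $ i) (min (b $ i - 2 * s) (c $ i + L - min L (5 * s))))"

definition enlarge :: "real ^ 'd \<Rightarrow> real \<Rightarrow> real ^ 'd \<Rightarrow> real \<Rightarrow> (real ^ 'd) set" where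
  "enlarge c L b s = cub (shifted_corner c L b s) (min L (5 * s))"

lemma enlarge_subset:
  assumes "0 < L" "0 < s"
  shows "enlarge c L b s \<subseteq> cub c L"
  unfolding enlarge_def using assms by (subst cub_subset_iff) (auto simp: shifted_corner_def)

text \<open>Clipping loses nothing because the covered cube lies in \<open>cub c L\<close>: either
  the side is already \<open>L\<close>, or the five-fold cube is only translated back
  inside.\<close>

lemma cub_subset_enlarge:
  fixes a b :: "real ^ 'd"
  assumes nd: "\<not> disjnt (cub a r) (cub b s)" and "r \<le> 2 * s" and sub: "cub a r \<subseteq> cub c L"
    and "0 < L"
  shows "cub a r \<subseteq> enlarge c L b s"
proof
  fix x assume x: "x \<in> cub a r"
  obtain z where z: "z \<in> cub a r" "z \<in> cub b s" using nd by (auto simp: disjnt_def)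
  have "shifted_corner c L b s $ i \<le> x $ i \<and> x $ i \<le> shifted_corner c L b s $ i + min L (5 * s)" for i
  proof -
    have "a $ i \<le> x $ i" "x $ i \<le> a $ i + r" "a $ i \<le> z $ i" "z $ i \<le> a $ i + r"
      "b $ i \<le> z $ i" "z $ i \<le> b $ i + s" "c $ i \<le> x $ i" "x $ i \<le> c $ i + L"
      using x z sub by (auto simp: mem_cub subset_iff)
    then show ?thesis using assms(2,4)
      unfolding shifted_corner_def vec_lambda_beta min_def max_def by (auto split: if_splits)
  qed
  then show "x \<in> enlarge c L b s" by (simp add: mem_cub enlarge_def)
qed

text \<open>Distinct powers of two sum to at most twice the largest. All levels can thus be summed
  at one point for a factor two instead of the number of levels.\<close>

lemma sum_powers_of_two_le:
  fixes M c :: ennreal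
  assumes "finite S" "\<And>m. m \<in> S \<Longrightarrow> 2 ^ m * c \<le> M"
  shows "(\<Sum>m\<in>S. 2 ^ m * c) \<le> 2 * M"
proof (cases "S = {}")
  case False
  have geo: "(\<Sum>m\<le>n. (2::ennreal) ^ m) \<le> 2 * 2 ^ n" for n :: nat
  proof (induction n)
    case (Suc n)
    have "(\<Sum>m\<le>Suc n. (2::ennreal) ^ m) \<le> 2 * 2 ^ n + 2 ^ Suc n"
      using Suc by (simp add: add_right_mono)
    also have "\<dots> = 2 * 2 ^ Suc n" by (simp add: mult_2)
    finally show ?case .
  qed simp
  have "(\<Sum>m\<in>S. (2::ennreal) ^ m) \<le> (\<Sum>m\<le>Max S. 2 ^ m)"
    using assms(1) by (intro sum_mono2) auto
  also have "\<dots> \<le> 2 * 2 ^ Max S" by (rule geo)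
  finally have "(\<Sum>m\<in>S. 2 ^ m) * c \<le> 2 * (2 ^ Max S * c)"
    by (metis mult.assoc mult_right_mono zero_le)
  also have "\<dots> \<le> 2 * M" using assms False by (intro mult_left_mono) auto
  finally show ?thesis by (simp add: sum_distrib_right)
qed simp

subsection \<open>Reverse Hoelder inequality for Fujii--Wilson weights\<close>

text \<open>The indicator of the union is at most the sum of the indicators; exchanging this sum
  with the integral avoids any enumeration of \<open>I\<close>.\<close>

lemma emeasure_UN_le_count_space:
  assumes X: "\<And>i. i \<in> I \<Longrightarrow> X i \<in> sets M" and I: "countable I"
  shows "emeasure M (\<Union>i\<in>I. X i) \<le> (\<integral>\<^sup>+ i. emeasure M (X i) \<partial>count_space I)"
proof -
  have "(\<Union>i\<in>I. X i) \<in> sets M" using X I by (intro sets.countable_UN') auto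
  then have "emeasure M (\<Union>i\<in>I. X i) = (\<integral>\<^sup>+ x. indicator (\<Union>i\<in>I. X i) x \<partial>M)" by simp
  also have "\<dots> \<le> (\<integral>\<^sup>+ x. (\<integral>\<^sup>+ i. indicator (X i) x \<partial>count_space I) \<partial>M)"
  proof (intro nn_integral_mono)
    fix x
    show "indicator (\<Union>i\<in>I. X i) x \<le> (\<integral>\<^sup>+ i. (indicator (X i) x :: ennreal) \<partial>count_space I)"
    proof (cases "x \<in> (\<Union>i\<in>I. X i)")
      case True
      then obtain i where i: "i \<in> I" "x \<in> X i" by blast
      have "(indicator (X i) x :: ennreal) \<le> (\<integral>\<^sup>+ i. indicator (X i) x \<partial>count_space I)"
        by (rule nn_integral_ge_point[OF i(1)])
      then show ?thesis using i True by simp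
    qed simp
  qed
  also have "\<dots> = (\<integral>\<^sup>+ i. (\<integral>\<^sup>+ x. indicator (X i) x \<partial>M) \<partial>count_space I)"
    using X by (intro nn_integral_count_space_nn_integral I) auto
  also have "\<dots> = (\<integral>\<^sup>+ i. emeasure M (X i) \<partial>count_space I)"
    using X by (intro nn_integral_cong) simp
  finally show ?thesis .
qed

lemma ennreal_le_mult_of_divide_le:
  fixes X Y B :: ennreal
  assumes "X / Y \<le> B" "Y \<noteq> 0" "Y \<noteq> top"
  shows "X \<le> B * Y"
proof -
  have "X = X / Y * Y" using assms(2,3) by (simp add: ennreal_divide_times less_top)
  also have "\<dots> \<le> B * Y" by (intro mult_right_mono assms) simp
  finally show ?thesis .
qed

text \<open>\<open>B\<close> is a real upper bound for the Fujii--Wilson constant, which permits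
  real arithmetic. Finiteness and positivity on cubes keep the quotients in
  \<open>Ainfty_const\<close> away from division by zero or infinity.\<close>

locale ainfty_weight =
  fixes w :: "real ^ 'd \<Rightarrow> real" and B :: real
  assumes w_meas [measurable]: "w \<in> borel_measurable lebesgue"
    and w_nonneg: "\<And>x. 0 \<le> w x"
    and w_fin: "\<And>a r. 0 < r \<Longrightarrow> (\<integral>\<^sup>+ x\<in>cub a r. ennreal (w x) \<partial>lebesgue) < \<infinity>"
    and w_pos: "\<And>a r. 0 < r \<Longrightarrow> 0 < (\<integral>\<^sup>+ x\<in>cub a r. ennreal (w x) \<partial>lebesgue)"
    and Ainfty_le: "Ainfty_const w \<le> ennreal B" and B_nonneg: "0 \<le> B"
begin

definition \<mu> :: "(real ^ 'd) measure" where
  "\<mu> = density lebesgue (\<lambda>x. ennreal (w x))"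

definition mean :: "real ^ 'd \<Rightarrow> real \<Rightarrow> real" where
  "mean a r = measure \<mu> (cub a r) / r ^ CARD('d)"

lemma sets_mu [simp, measurable_cong]: "sets \<mu> = sets lebesgue"
  by (simp add: \<mu>_def)

lemma emeasure_mu: "A \<in> sets lebesgue \<Longrightarrow> emeasure \<mu> A = (\<integral>\<^sup>+ x\<in>A. ennreal (w x) \<partial>lebesgue)"
  unfolding \<mu>_def by (rule emeasure_density) auto

lemma emeasure_mu_cub:
  assumes "0 < r"
  shows "emeasure \<mu> (cub a r) = ennreal (mean a r * r ^ CARD('d))"
proof -
  have "emeasure \<mu> (cub a r) \<noteq> \<infinity>" using w_fin[OF assms, of a] by (simp add: emeasure_mu)
  then have "emeasure \<mu> (cub a r) = ennreal (measure \<mu> (cub a r))"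
    by (metis emeasure_eq_ennreal_measure infinity_ennreal_def)
  then show ?thesis using assms by (simp add: mean_def)
qed

lemma mean_pos:
  assumes "0 < r"
  shows "0 < mean a r"
proof -
  have "0 < ennreal (mean a r * r ^ CARD('d))"
    using w_pos[OF assms, of a] by (simp add: emeasure_mu_cub[OF assms, symmetric] emeasure_mu)
  then show ?thesis using assms by (simp add: ennreal_less_zero_iff zero_less_mult_iff)
qed

lemma mean_le_hl_maximal:
  assumes "0 < s" "cub b s \<subseteq> Q" "x \<in> cub b s"
  shows "ennreal (mean b s) \<le> hl_maximal (\<lambda>y. w y * indicator Q y) x"
proof -
  have "(\<integral>\<^sup>+ y\<in>cub b s. ennreal \<bar>w y * indicator Q y\<bar> \<partial>lebesgue) = emeasure \<mu> (cub b s)"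
    unfolding emeasure_mu[OF sets_cub]
    using assms(2) w_nonneg by (intro nn_integral_cong) (auto split: split_indicator)
  then have "avg (cub b s) (\<lambda>y. ennreal \<bar>w y * indicator Q y\<bar>) =
      ennreal (mean b s * s ^ CARD('d)) / ennreal (s ^ CARD('d))"
    using assms(1) unfolding avg_def by (simp only: emeasure_mu_cub emeasure_cub less_imp_le)
  also have "\<dots> = ennreal (mean b s)"
    using assms(1) mean_pos[OF assms(1), of b] by (simp add: divide_ennreal)
  finally show ?thesis
    unfolding hl_maximal_def using assms by (auto intro!: SUP_upper2[of "cub b s"] cube_cub)
qed

lemma integral_hl_maximal_le:
  assumes "0 < L"
  shows "(\<integral>\<^sup>+ x\<in>cub c L. hl_maximal (\<lambda>y. w y * indicator (cub c L) y) x \<partial>lebesgue)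
    \<le> ennreal B * emeasure \<mu> (cub c L)"
proof (rule ennreal_le_mult_of_divide_le)
  show "(\<integral>\<^sup>+ x\<in>cub c L. hl_maximal (\<lambda>y. w y * indicator (cub c L) y) x \<partial>lebesgue) /
      emeasure \<mu> (cub c L) \<le> ennreal B"
    unfolding emeasure_mu[OF sets_cub]
    by (rule order_trans[OF _ Ainfty_le], unfold Ainfty_const_def, rule SUP_upper2[of "cub c L"])
      (auto intro: cube_cub assms)
  show "emeasure \<mu> (cub c L) \<noteq> 0" "emeasure \<mu> (cub c L) \<noteq> top"
    using w_pos[OF assms, of c] w_fin[OF assms, of c] by (simp_all add: emeasure_mu)
qed

text \<open>A stopping family at height \<open>t\<close>. The lower bound on the chosen means limits
  the measure of the chosen cubes; the upper bound on the enlarged means limits the mass that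
  \<open>w\<close> puts on the sets covering all subcubes of large mean.\<close>

definition selected where
  "selected c L t J \<longleftrightarrow> countable J \<and> disjoint_family_on (\<lambda>(a, r). cub a r) J \<and>
    (\<forall>(b, s)\<in>J. 0 < s \<and> cub b s \<subseteq> cub c L \<and> t \<le> mean b s \<and>
      mean (shifted_corner c L b s) (min L (5 * s)) < t) \<and>
    (\<forall>a r. 0 < r \<and> cub a r \<subseteq> cub c L \<and> t \<le> mean a r \<longrightarrow>
      (\<exists>(b, s)\<in>J. cub a r \<subseteq> enlarge c L b s))"

text \<open>Vitali's lemma is applied to the cubes of mean at least \<open>t\<close> whose next
  enlargement falls below \<open>t\<close>. Every cube of large mean lies in such a cube, hence in
  the enlargement of a selected one.\<close>

lemma selected_exists:
  assumes L: "0 < L" and t: "mean c L < t"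
  shows "\<exists>J. selected c L t J"
proof -
  define I where "I = {(b, s). 0 < s \<and> cub b s \<subseteq> cub c L \<and> t \<le> mean b s \<and>
      mean (shifted_corner c L b s) (min L (5 * s)) < t}"
  have le_L: "r \<le> L" if "0 < r" "cub a r \<subseteq> cub c L" for a r
  proof -
    have "c $ undefined \<le> a $ undefined \<and> a $ undefined + r \<le> c $ undefined + L"
      using that cub_subset_iff[of r a c L] by simp
    then show ?thesis by linarith
  qed
  have I_L: "0 < s \<and> s \<le> L" if "(b, s) \<in> I" for b s
    using that le_L[of s b] by (auto simp: I_def)
  obtain J where J: "J \<subseteq> I" "countable J" "disjoint_family_on (\<lambda>(a, r). cub a r) J"
    and cover: "\<And>a r. (a, r) \<in> I \<Longrightarrow> \<exists>(b, s)\<in>J. \<not> disjnt (cub a r) (cub b s) \<and> r \<le> 2 * s"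
    by (rule vitali_cubes[of I L]; (rule I_L that; assumption))
  \<comment> \<open>Enlarging repeatedly must stop, since the last cube \<open>cub c L\<close> has mean below \<open>t\<close>.\<close>
  have maximal: "\<exists>(b, s)\<in>I. cub a r \<subseteq> cub b s"
    if "0 < r" "cub a r \<subseteq> cub c L" "t \<le> mean a r" "L \<le> r * 5 ^ k" for a r k
    using that
  \<comment> \<open>\<open>k\<close> bounds the number of enlargements left before the side reaches
    \<open>L\<close>.\<close>
  proof (induction k arbitrary: a r)
    case 0
    then have "r = L" using le_L[of r a] by simp
    moreover have "a = c"
      using 0 L \<open>r = L\<close> by (simp add: cub_subset_iff vec_eq_iff) (meson order_antisym)
    ultimately show ?case using 0 t by simp
  next
    case (Suc k)
    let ?a = "shifted_corner c L a r" and ?r = "min L (5 * r)"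
    have sub: "cub a r \<subseteq> cub ?a ?r"
    proof -
      have "\<not> disjnt (cub a r) (cub a r)" using corner_in_cub[of r a] Suc.prems(1) by (auto simp: disjnt_def)
      then show ?thesis
        using cub_subset_enlarge[of a r a r c L] Suc.prems L by (simp add: enlarge_def)
    qed
    show ?case
    proof (cases "mean ?a ?r < t")
      case True
      then have "(a, r) \<in> I" using Suc.prems by (simp add: I_def)
      then show ?thesis by blast
    next
      case False
      have "L \<le> ?r * 5 ^ k"
      proof (cases "L \<le> 5 * r")
        case True
        have "L * 1 \<le> L * 5 ^ k" using L by (intro mult_left_mono) auto
        then show ?thesis using True by simp
      next
        case False
        then show ?thesis using Suc.prems(4) by (simp add: mult_ac)
      qed
      moreover have "cub ?a ?r \<subseteq> cub c L"
        using enlarge_subset[OF L Suc.prems(1), of c a] by (simp add: enlarge_def)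
      ultimately have "\<exists>(b, s)\<in>I. cub ?a ?r \<subseteq> cub b s"
        using Suc.IH[of ?r ?a] False Suc.prems(1) L by simp
      then show ?thesis using sub by blast
    qed
  qed
  have "\<exists>(b, s)\<in>J. cub a r \<subseteq> enlarge c L b s"
    if ar: "0 < r" "cub a r \<subseteq> cub c L" "t \<le> mean a r" for a r
  proof -
    obtain k where "L / r < 5 ^ k" using real_arch_pow[of 5 "L / r"] by auto
    then have "L \<le> r * 5 ^ k" using ar(1) by (simp add: field_simps)
    then obtain b s where bs: "(b, s) \<in> I" "cub a r \<subseteq> cub b s" using maximal[OF ar] by blast
    obtain b' s' where b': "(b', s') \<in> J" "\<not> disjnt (cub b s) (cub b' s')" "s \<le> 2 * s'"
      using cover[OF bs(1)] by blast
    have "cub b s \<subseteq> enlarge c L b' s'"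
      using bs(1) L by (intro cub_subset_enlarge b') (auto simp: I_def)
    then show ?thesis using b'(1) bs(2) by blast
  qed
  then have "selected c L t J"
    unfolding selected_def using J by (auto simp: I_def)
  then show ?thesis by blast
qed

section \<open>Lebesgue differentiation along cubes\<close>

lemma w_integrable: "set_integrable lebesgue (cub a r) w"
proof (cases "0 < r")
  case True
  have "(\<integral>\<^sup>+ x. ennreal (norm (indicator (cub a r) x *\<^sub>R w x)) \<partial>lebesgue) =
      (\<integral>\<^sup>+ x\<in>cub a r. ennreal (w x) \<partial>lebesgue)"
    using w_nonneg by (intro nn_integral_cong) (auto split: split_indicator)
  then show ?thesis
    unfolding set_integrable_def using w_fin[OF True, of a]
    by (intro integrableI_bounded) auto
next
  case False
  then have "cub a r \<subseteq> {a}" by (auto simp: mem_cub vec_eq_iff) (smt (verit))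
  then have "emeasure lebesgue (cub a r) = 0"
    using emeasure_mono[of "cub a r" "{a}" lebesgue] by simp
  then have "AE x in lebesgue. indicator (cub a r) x *\<^sub>R w x = 0"
    by (intro AE_I[of _ _ "cub a r"]) (auto split: split_indicator)
  then show ?thesis unfolding set_integrable_def
    by (subst integrable_cong_AE[of _ _ "\<lambda>_. 0"]) auto
qed

text \<open>Links \<open>\<mu>\<close> to the gauge integral, in which the differentiation theorem
  used below is phrased.\<close>

lemma integral_cub: "0 < r \<Longrightarrow> integral (cub a r) w = measure \<mu> (cub a r)"
proof -
  assume r: "0 < r"
  have "integral (cub a r) w = (LINT x:cub a r|lebesgue. w x)"
    using set_lebesgue_integral_eq_integral(2)[OF w_integrable] by simp
  also have "\<dots> = enn2real (\<integral>\<^sup>+ x. ennreal (indicator (cub a r) x *\<^sub>R w x) \<partial>lebesgue)"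
    unfolding set_lebesgue_integral_def using w_nonneg
    by (intro integral_eq_nn_integral) auto
  also have "(\<integral>\<^sup>+ x. ennreal (indicator (cub a r) x *\<^sub>R w x) \<partial>lebesgue) = emeasure \<mu> (cub a r)"
    unfolding emeasure_mu[OF sets_cub] by (intro nn_integral_cong) (auto split: split_indicator)
  finally show ?thesis by (simp add: measure_def)
qed

lemma w_integrable_on: "w integrable_on cbox a b"
proof -
  obtain r where r: "0 < r" "cbox a b \<subseteq> cub a r"
  proof
    let ?r = "1 + (\<Sum>i\<in>UNIV. \<bar>b $ i - a $ i\<bar>)"
    show "0 < ?r" by (smt (verit) sum_nonneg abs_ge_zero)
    have side: "\<bar>b $ i - a $ i\<bar> \<le> (\<Sum>i\<in>UNIV. \<bar>b $ i - a $ i\<bar>)" for i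
      by (rule member_le_sum) auto
    show "cbox a b \<subseteq> cub a ?r"
    proof
      fix x assume "x \<in> cbox a b"
      then have "a $ i \<le> x $ i \<and> x $ i \<le> a $ i + ?r" for i
        using side[of i] by (auto simp: mem_box_cart dest!: spec[of _ i])
      then show "x \<in> cub a ?r" by (simp add: mem_cub)
    qed
  qed
  have "set_integrable lebesgue (cbox a b) w"
    using set_integrable_subset[OF w_integrable _ r(2)] by simp
  then show ?thesis by (rule set_lebesgue_integral_eq_integral(1))
qed

text \<open>For almost every \<open>x\<close> the means over cubes with lower corner
  \<open>x\<close> tend to \<open>w x\<close>. The frontier of \<open>cub c L\<close> is null, and
  off it small cubes of this kind stay inside \<open>cub c L\<close>.\<close>

lemma AE_mean_ge:
  assumes L: "0 < L"
  shows "AE x in lebesgue. \<forall>t. x \<in> cub c L \<longrightarrow> t < w x \<longrightarrow>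
    (\<exists>r>0. cub x r \<subseteq> cub c L \<and> t \<le> mean x r)"
proof -
  obtain N where N: "negligible N" and lim: "\<And>x e. \<lbrakk>x \<notin> N; 0 < e\<rbrakk> \<Longrightarrow>
      \<exists>d>0. \<forall>h. 0 < h \<and> h < d \<longrightarrow>
        norm (integral (cbox x (x + h *\<^sub>R One)) w /\<^sub>R h ^ DIM(real ^ 'd) - w x) < e"
    using integrable_ccontinuous_explicit[of w] w_integrable_on by blast
  define F where "F = cub c L - box c (\<chi> i. c $ i + L)"
  have "negligible (N \<union> F)"
    unfolding F_def cub_def by (intro negligible_Un N negligible_frontier_interval)
  then have null: "N \<union> F \<in> null_sets lebesgue" by (simp add: negligible_iff_null_sets)
  show ?thesis
  proof (rule AE_I'[OF null], rule subsetI, rule ccontr)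
    fix x assume "x \<in> {x \<in> space lebesgue. \<not> (\<forall>t. x \<in> cub c L \<longrightarrow> t < w x \<longrightarrow>
      (\<exists>r>0. cub x r \<subseteq> cub c L \<and> t \<le> mean x r))}" and "x \<notin> N \<union> F"
    then obtain t where x: "x \<in> cub c L" "t < w x" "x \<notin> F" "x \<notin> N"
      and no: "\<not> (\<exists>r>0. cub x r \<subseteq> cub c L \<and> t \<le> mean x r)"
      by auto
    obtain d where d: "0 < d" "\<And>h. 0 < h \<Longrightarrow> h < d \<Longrightarrow>
        norm (integral (cbox x (x + h *\<^sub>R One)) w /\<^sub>R h ^ DIM(real ^ 'd) - w x) < w x - t"
      using lim[OF x(4), of "w x - t"] x(2) by auto
    have gap: "0 < c $ i + L - x $ i" for i
      using x(1,3) by (auto simp: F_def mem_box_cart)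
    define h where "h = min (d / 2) (Min (range (\<lambda>i. c $ i + L - x $ i)))"
    have h: "0 < h" "h < d" using d(1) gap by (auto simp: h_def min_def)
    have "x $ i + h \<le> c $ i + L" for i
    proof -
      have "Min (range (\<lambda>i. c $ i + L - x $ i)) \<le> c $ i + L - x $ i" by (rule Min_le) auto
      then show ?thesis unfolding h_def by linarith
    qed
    then have "cub x h \<subseteq> cub c L"
      using x(1) h by (subst cub_subset_iff) (auto simp: mem_cub)
    moreover have "t \<le> mean x h"
    proof -
      have One_nth: "(One :: real ^ 'd) $ i = 1" for i
        unfolding cart_eq_inner_axis
        by (subst inner_sum_left, subst sum.cong[OF refl, of _ _ "\<lambda>b. if b = axis i 1 then 1 else 0"])
          (auto simp: inner_Basis axis_in_Basis_iff)
      have "x + h *\<^sub>R One = (\<chi> i. x $ i + h)"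
        using One_nth by (simp add: vec_eq_iff)
      then have "integral (cbox x (x + h *\<^sub>R One)) w = measure \<mu> (cub x h)"
        using integral_cub[OF h(1), of x] by (simp add: cub_def)
      then have "integral (cbox x (x + h *\<^sub>R One)) w /\<^sub>R h ^ DIM(real ^ 'd) = mean x h"
        by (simp add: mean_def field_simps)
      then show ?thesis using d(2)[OF h] by simp
    qed
    ultimately show False using no h by blast
  qed
qed

text \<open>The reverse Hoelder inequality in distributional form. The decay rate per \<open>N\<close> doublings, with \<open>N\<close>
  comparable to the Fujii--Wilson constant, is what makes the final bound linear in that constant.\<close>

lemma decay:
  assumes N: "0 < N" "4 * 5 ^ CARD('d) * B \<le> real N" and "0 < L"
  shows "emeasure \<mu> {x \<in> cub c L. 2 ^ (j * N) * mean c L < w x} \<le>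
    ennreal ((1 / 2) ^ j) * emeasure \<mu> (cub c L)"
  using \<open>0 < L\<close>
proof (induction j arbitrary: c L)
  case 0
  show ?case by (auto intro: emeasure_mono)
next
  case (Suc j)
  define A where "A = mean c L"
  define v where "v = A * L ^ CARD('d)"
  have A: "0 < A" unfolding A_def by (rule mean_pos[OF Suc.prems])
  have v: "0 < v" "emeasure \<mu> (cub c L) = ennreal v"
    using A Suc.prems by (auto simp: v_def A_def emeasure_mu_cub)
  \<comment> \<open>Levels start at \<open>m = 1\<close> because selection needs a height strictly
    above the mean \<open>A\<close>.\<close>
  have "\<exists>J. selected c L (2 ^ m * A) J" if "1 \<le> m" for m :: nat
  proof (rule selected_exists[OF Suc.prems])
    have "(2::real) ^ 1 \<le> 2 ^ m" using that by (intro power_increasing) auto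
    then have "1 * A < 2 ^ m * A" using A by (intro mult_strict_right_mono) auto
    then show "mean c L < 2 ^ m * A" by (simp add: A_def)
  qed
  then obtain J where J: "\<And>m. 1 \<le> m \<Longrightarrow> selected c L (2 ^ m * A) (J m)" by metis
  define U where "U m = (\<Union>(b, s)\<in>J m. cub b s)" for m
  have J_count: "countable (J m)" if "1 \<le> m" for m using J[OF that] by (simp add: selected_def)
  have U_sets: "U m \<in> sets lebesgue" if "1 \<le> m" for m
    unfolding U_def using J_count[OF that] by (intro sets.countable_UN') auto
  have U_sub: "U m \<subseteq> cub c L" if "1 \<le> m" for m
    using J[OF that] unfolding U_def selected_def by blast
  define M where "M = hl_maximal (\<lambda>y. w y * indicator (cub c L) y)"
  have M_ge: "2 ^ m * ennreal A \<le> M x" if m: "1 \<le> m" and x: "x \<in> U m" for m x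
  proof -
    obtain b s where bs: "(b, s) \<in> J m" "x \<in> cub b s" using x by (auto simp: U_def)
    then have *: "0 < s" "cub b s \<subseteq> cub c L" "2 ^ m * A \<le> mean b s"
      using J[OF m] by (auto simp: selected_def)
    have "2 ^ m * ennreal A = ennreal (2 ^ m * A)"
      using A by (simp add: ennreal_mult ennreal_power[symmetric])
    also have "\<dots> \<le> ennreal (mean b s)" using * by (intro ennreal_leI)
    also have "\<dots> \<le> M x" unfolding M_def using * bs by (intro mean_le_hl_maximal)
    finally show ?thesis .
  qed
  \<comment> \<open>At each point the terms present are all at most \<open>M x\<close>, so the sum
    over levels costs only a factor two; then the Fujii--Wilson bound is integrated.\<close>
  have "(\<Sum>m\<in>{1..N}. 2 ^ m * ennreal A * emeasure lebesgue (U m)) \<le> 2 * (ennreal B * ennreal v)"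
  proof -
    have pt: "ennreal (1 / 2) * (\<Sum>m\<in>{1..N}. 2 ^ m * ennreal A * indicator (U m) x) \<le> M x * indicator (cub c L) x" for x
    proof -
      have "(\<Sum>m\<in>{1..N}. 2 ^ m * ennreal A * indicator (U m) x) =
          (\<Sum>m\<in>{m\<in>{1..N}. x \<in> U m}. 2 ^ m * ennreal A)"
        by (rule sum.mono_neutral_cong_right) auto
      also have "\<dots> \<le> 2 * (M x * indicator (cub c L) x)"
      proof (rule sum_powers_of_two_le)
        fix m assume "m \<in> {m\<in>{1..N}. x \<in> U m}"
        then have "1 \<le> m" "x \<in> U m" by auto
        then show "2 ^ m * ennreal A \<le> M x * indicator (cub c L) x"
          using M_ge U_sub by (auto simp: indicator_def)
      qed simp
      finally have "ennreal (1 / 2) * (\<Sum>m\<in>{1..N}. 2 ^ m * ennreal A * indicator (U m) x) \<le>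
          ennreal (1 / 2) * (2 * (M x * indicator (cub c L) x))"
        by (rule mult_left_mono) simp
      also have "\<dots> = (ennreal (1 / 2) * ennreal 2) * (M x * indicator (cub c L) x)"
        by (simp add: mult.assoc)
      also have "ennreal (1 / 2) * ennreal 2 = 1" by (subst ennreal_mult[symmetric]) auto
      finally show ?thesis by simp
    qed
    have half: "ennreal (1 / 2) * (\<Sum>m\<in>{1..N}. 2 ^ m * ennreal A * emeasure lebesgue (U m)) =
        (\<integral>\<^sup>+ x. ennreal (1 / 2) * (\<Sum>m\<in>{1..N}. 2 ^ m * ennreal A * indicator (U m) x) \<partial>lebesgue)"
    proof -
      have "(\<integral>\<^sup>+ x. ennreal (1 / 2) * (\<Sum>m\<in>{1..N}. 2 ^ m * ennreal A * indicator (U m) x) \<partial>lebesgue)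
        = ennreal (1 / 2) * (\<integral>\<^sup>+ x. (\<Sum>m\<in>{1..N}. 2 ^ m * ennreal A * indicator (U m) x) \<partial>lebesgue)"
        using U_sets by (intro nn_integral_cmult borel_measurable_sum borel_measurable_times borel_measurable_const borel_measurable_indicator) auto
      also have "(\<integral>\<^sup>+ x. (\<Sum>m\<in>{1..N}. 2 ^ m * ennreal A * indicator (U m) x) \<partial>lebesgue)
        = (\<Sum>m\<in>{1..N}. (\<integral>\<^sup>+ x. 2 ^ m * ennreal A * indicator (U m) x \<partial>lebesgue))"
        using U_sets by (intro nn_integral_sum borel_measurable_times borel_measurable_const borel_measurable_indicator) auto
      also have "\<dots> = (\<Sum>m\<in>{1..N}. 2 ^ m * ennreal A * emeasure lebesgue (U m))"
        using U_sets by (intro sum.cong nn_integral_cmult_indicator) auto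
      finally show ?thesis ..
    qed
    also have "\<dots> \<le> (\<integral>\<^sup>+ x\<in>cub c L. M x \<partial>lebesgue)" by (intro nn_integral_mono pt)
    also have "\<dots> \<le> ennreal B * ennreal v"
      using integral_hl_maximal_le[OF Suc.prems, of c] by (simp add: M_def v(2))
    finally have "ennreal 2 * (ennreal (1 / 2) * (\<Sum>m\<in>{1..N}. 2 ^ m * ennreal A * emeasure lebesgue (U m)))
        \<le> ennreal 2 * (ennreal B * ennreal v)"
      by (rule mult_left_mono) simp
    moreover have "ennreal 2 * ennreal (1 / 2) = 1" by (subst ennreal_mult[symmetric]) auto
    ultimately show ?thesis unfolding mult.assoc[symmetric] by simp
  qed
  \<comment> \<open>Pigeonhole: one of the \<open>N\<close> levels carries at most the average of the sum.\<close>
  moreover obtain m where m: "m \<in> {1..N}" and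
    "of_nat N * (2 ^ m * ennreal A * emeasure lebesgue (U m)) \<le>
      (\<Sum>m\<in>{1..N}. 2 ^ m * ennreal A * emeasure lebesgue (U m))"
  proof -
    let ?g = "\<lambda>m. 2 ^ m * ennreal A * emeasure lebesgue (U m)"
    have "Min (?g ` {1..N}) \<in> ?g ` {1..N}" using N(1) by (intro Min_in) auto
    then obtain m where m: "m \<in> {1..N}" "Min (?g ` {1..N}) = ?g m" by auto
    have "of_nat (card {1..N}) * ?g m \<le> sum ?g {1..N}"
      by (rule sum_bounded_below) (simp flip: m(2))
    then show ?thesis using that m(1) by simp
  qed
  ultimately have key: "of_nat N * (2 ^ m * ennreal A * emeasure lebesgue (U m)) \<le> 2 * (ennreal B * ennreal v)"
    using order_trans by blast
  have m1: "1 \<le> m" using m by simp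
  define t where "t = 2 ^ m * A"
  have t: "0 < t" using A by (simp add: t_def)
  \<comment> \<open>\<open>E p\<close> is the exceptional set of the induction hypothesis for the
    enlargement of the cube \<open>p\<close>.\<close>
  define E where "E p = {x \<in> enlarge c L (fst p) (snd p). 2 ^ (j * N) * mean (shifted_corner c L (fst p) (snd p)) (min L (5 * snd p)) < w x}" for p
  have E_sets: "E p \<in> sets lebesgue" for p
    unfolding E_def enlarge_def by measurable
  have selJ: "selected c L t (J m)" using J[OF m1] by (simp add: t_def)
  \<comment> \<open>A point where \<open>w\<close> exceeds \<open>2 ^ (Suc j * N) * A\<close> has a
    cube of mean at least \<open>t\<close>, contained in some selected enlargement. That enlargement
    has mean below \<open>t \<le> 2 ^ N * A\<close>, so the point is exceptional there at stage
    \<open>j\<close>.\<close>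
  have cover: "AE x in \<mu>. x \<in> {x \<in> cub c L. 2 ^ (Suc j * N) * A < w x} \<longrightarrow> x \<in> (\<Union>p\<in>J m. E p)"
  proof -
    have "AE x in lebesgue. x \<in> {x \<in> cub c L. 2 ^ (Suc j * N) * A < w x} \<longrightarrow> x \<in> (\<Union>p\<in>J m. E p)"
      using AE_mean_ge[OF Suc.prems, of c]
    proof eventually_elim
      case (elim x)
      show ?case
      proof
        assume x: "x \<in> {x \<in> cub c L. 2 ^ (Suc j * N) * A < w x}"
        have tN: "t \<le> 2 ^ N * A" unfolding t_def using m A by (intro mult_right_mono power_increasing) auto
        have "2 ^ (j * N) * t \<le> 2 ^ (j * N) * (2 ^ N * A)" using tN by (intro mult_left_mono) auto
        also have "\<dots> = 2 ^ (Suc j * N) * A" by (simp add: power_add)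
        finally have tw: "2 ^ (j * N) * t < w x" using x by auto
        have "1 * t \<le> 2 ^ (j * N) * t" using t by (intro mult_right_mono) auto
        then have "t < w x" using tw by simp
        then obtain r where r: "0 < r" "cub x r \<subseteq> cub c L" "t \<le> mean x r" using elim x by blast
        then obtain b s where bs: "(b, s) \<in> J m" "cub x r \<subseteq> enlarge c L b s"
          using selJ unfolding selected_def by blast
        have "mean (shifted_corner c L b s) (min L (5 * s)) < t"
          using selJ bs(1) unfolding selected_def by blast
        then have "2 ^ (j * N) * mean (shifted_corner c L b s) (min L (5 * s)) < 2 ^ (j * N) * t"
          by (intro mult_strict_left_mono) auto
        then have "2 ^ (j * N) * mean (shifted_corner c L b s) (min L (5 * s)) < w x"
          using tw by (rule less_trans)
        then have "x \<in> E (b, s)"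
          using bs(2) corner_in_cub[of r x] r(1) by (auto simp: E_def)
        then show "x \<in> (\<Union>p\<in>J m. E p)" using bs(1) by blast
      qed
    qed
    then show ?thesis unfolding \<mu>_def by (subst AE_density) auto
  qed
  have E_le: "emeasure \<mu> (E p) \<le> ennreal ((1 / 2) ^ j * (5 ^ CARD('d) * t)) * emeasure lebesgue (cub (fst p) (snd p))"
    if "p \<in> J m" for p
  proof -
    obtain b s where p: "p = (b, s)" by force
    have s: "0 < s" and lt: "mean (shifted_corner c L b s) (min L (5 * s)) < t"
      using selJ that unfolding selected_def p by blast+
    have side: "0 < min L (5 * s)" using s Suc.prems by simp
    have "emeasure \<mu> (E p) \<le> ennreal ((1 / 2) ^ j) * emeasure \<mu> (enlarge c L b s)"
      using Suc.IH[OF side, of "shifted_corner c L b s"] unfolding E_def p enlarge_def by simp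
    also have "emeasure \<mu> (enlarge c L b s) \<le> ennreal (t * (5 * s) ^ CARD('d))"
      unfolding enlarge_def emeasure_mu_cub[OF side]
      using lt mean_pos[OF side] s side t
      by (intro ennreal_leI mult_mono power_mono) (auto intro: less_imp_le)
    finally have "emeasure \<mu> (E p) \<le> ennreal ((1 / 2) ^ j) * ennreal (t * (5 * s) ^ CARD('d))"
      by (simp add: mult_left_mono)
    also have "\<dots> = ennreal ((1 / 2) ^ j * (5 ^ CARD('d) * t)) * ennreal (s ^ CARD('d))"
      using s t by (simp add: ennreal_mult[symmetric] power_mult_distrib mult_ac)
    also have "ennreal (s ^ CARD('d)) = emeasure lebesgue (cub b s)" using s by (simp only: emeasure_cub less_imp_le)
    finally show ?thesis by (simp add: p)
  qed
  have "emeasure \<mu> {x \<in> cub c L. 2 ^ (Suc j * N) * A < w x} \<le> emeasure \<mu> (\<Union>p\<in>J m. E p)"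
    using cover by (rule emeasure_mono_AE) (use E_sets J_count[OF m1] in \<open>auto intro!: sets.countable_UN'\<close>)
  also have "\<dots> \<le> (\<integral>\<^sup>+ p. emeasure \<mu> (E p) \<partial>count_space (J m))"
    using E_sets J_count[OF m1] by (intro emeasure_UN_le_count_space) auto
  also have "\<dots> \<le> (\<integral>\<^sup>+ p. ennreal ((1 / 2) ^ j * (5 ^ CARD('d) * t)) * emeasure lebesgue (cub (fst p) (snd p)) \<partial>count_space (J m))"
    by (intro nn_integral_mono E_le) simp
  also have "\<dots> = ennreal ((1 / 2) ^ j * (5 ^ CARD('d) * t)) * (\<integral>\<^sup>+ p. emeasure lebesgue (cub (fst p) (snd p)) \<partial>count_space (J m))"
    by (rule nn_integral_cmult) simp
  also have "(\<integral>\<^sup>+ p. emeasure lebesgue (cub (fst p) (snd p)) \<partial>count_space (J m)) = emeasure lebesgue (U m)"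
  proof -
    have eq: "(\<lambda>p. cub (fst p) (snd p)) = (\<lambda>(a :: real ^ 'd, r). cub a r)" by auto
    have "disjoint_family_on (\<lambda>p. cub (fst p) (snd p)) (J m)"
      using selJ unfolding selected_def eq by blast
    then have "emeasure lebesgue (\<Union>p\<in>J m. cub (fst p) (snd p)) = (\<integral>\<^sup>+ p. emeasure lebesgue (cub (fst p) (snd p)) \<partial>count_space (J m))"
      using J_count[OF m1] by (intro emeasure_UN_countable) auto
    then show ?thesis unfolding U_def eq by (rule sym)
  qed
  also have "ennreal ((1 / 2) ^ j * (5 ^ CARD('d) * t)) * emeasure lebesgue (U m) \<le> ennreal ((1 / 2) ^ Suc j) * ennreal v"
  proof -
    have "emeasure lebesgue (U m) \<le> emeasure lebesgue (cub c L)" using U_sub[OF m1] by (intro emeasure_mono) auto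
    also have "\<dots> < \<infinity>" using Suc.prems by (simp only: emeasure_cub less_imp_le) simp
    finally obtain u where u: "0 \<le> u" "emeasure lebesgue (U m) = ennreal u"
      by (metis ennreal_cases infinity_ennreal_def less_irrefl)
    have "ennreal (real N * (t * u)) \<le> ennreal (2 * (B * v))"
      using key u t v(1) B_nonneg A
      by (simp add: t_def ennreal_mult ennreal_power[symmetric] ennreal_of_nat_eq_real_of_nat mult.assoc)
    then have "real N * (t * u) \<le> 2 * (B * v)" using B_nonneg v(1) by simp
    \<comment> \<open>In \<open>4 * 5 ^ CARD('d)\<close> one factor two comes from the geometric
      sum, \<open>5 ^ CARD('d)\<close> from the enlargement, and the other two yields the gain of
      one half.\<close>
    then have "5 ^ CARD('d) * (real N * (t * u)) \<le> 5 ^ CARD('d) * (2 * (B * v))"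
      by (rule mult_left_mono) simp
    also have "\<dots> = (4 * 5 ^ CARD('d) * B) * (v / 2)" by simp
    also have "\<dots> \<le> real N * (v / 2)" using N(2) v(1) by (intro mult_right_mono) auto
    finally have "real N * (5 ^ CARD('d) * t * u) \<le> real N * (v / 2)" by (simp add: mult_ac)
    then have "5 ^ CARD('d) * t * u \<le> v / 2" using N(1) by simp
    then have "(1 / 2) ^ j * (5 ^ CARD('d) * t * u) \<le> (1 / 2) ^ j * (v / 2)" by (rule mult_left_mono) simp
    then have "(1 / 2) ^ j * (5 ^ CARD('d) * t) * u \<le> (1 / 2) ^ Suc j * v" by (simp add: mult_ac)
    then show ?thesis using u t v(1) by (simp only: u(2) flip: ennreal_mult) (simp add: ennreal_leI flip: ennreal_mult)
  qed
  finally show ?case by (simp only: A_def v(2))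
qed

end

subsection \<open>Matrix A1 weights\<close>

text \<open>On a cube the localised maximal function is at least the mean, so the Fujii--Wilson
  quotient is at least one. Rounding and additive constants are later absorbed this way.\<close>

lemma (in ainfty_weight) one_le_B: "1 \<le> B"
proof -
  let ?Q = "cub (0 :: real ^ 'd) 1"
  have "emeasure \<mu> ?Q = (\<integral>\<^sup>+ x\<in>?Q. ennreal (mean 0 1) \<partial>lebesgue)"
    using emeasure_mu_cub[of 1 0] emeasure_cub[of 1 "0 :: real ^ 'd"]
    by (subst nn_integral_cmult_indicator) simp_all
  also have "\<dots> \<le> (\<integral>\<^sup>+ x\<in>?Q. hl_maximal (\<lambda>y. w y * indicator ?Q y) x \<partial>lebesgue)"
    by (intro nn_integral_mono) (auto split: split_indicator intro!: mean_le_hl_maximal)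
  also have "\<dots> \<le> ennreal B * emeasure \<mu> ?Q" by (rule integral_hl_maximal_le) simp
  finally have "ennreal (mean 0 1) \<le> ennreal (B * mean 0 1)"
    using mean_pos[of 1 0] B_nonneg by (simp add: emeasure_mu_cub ennreal_mult)
  then have "1 * mean 0 1 \<le> B * mean 0 1" using mean_pos[of 1 0] B_nonneg by simp
  then show ?thesis using mean_pos[of 1 0] by (subst (asm) mult_le_cancel_right) auto
qed

text \<open>Chebyshev's inequality gives the factor \<open>(1 / 2) ^ m\<close> and
  \<open>decay\<close> at stage \<open>m div N\<close> gives the other; since the mean is at most
  one, the threshold of that stage is at most \<open>2 ^ m\<close>.\<close>

lemma (in ainfty_weight) lebesgue_decay:
  assumes N: "0 < N" "4 * 5 ^ CARD('d) * B \<le> real N" and L: "0 < L" and le1: "mean c L \<le> 1"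
  shows "emeasure lebesgue {x \<in> cub c L. 2 ^ m < w x} \<le>
    ennreal ((1 / 2) ^ m * (1 / 2) ^ (m div N)) * emeasure lebesgue (cub c L)"
proof -
  let ?S = "{x \<in> cub c L. 2 ^ m < w x}" and ?j = "m div N"
  have S: "?S \<in> sets lebesgue" by measurable
  have "ennreal (2 ^ m) * emeasure lebesgue ?S = (\<integral>\<^sup>+ x. ennreal (2 ^ m) * indicator ?S x \<partial>lebesgue)"
    using S by (simp add: nn_integral_cmult_indicator)
  also have "\<dots> \<le> (\<integral>\<^sup>+ x\<in>?S. ennreal (w x) \<partial>lebesgue)"
    by (intro nn_integral_mono) (auto split: split_indicator intro!: ennreal_leI)
  also have "\<dots> = emeasure \<mu> ?S" by (rule emeasure_mu[OF S, symmetric])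
  also have "\<dots> \<le> emeasure \<mu> {x \<in> cub c L. 2 ^ (?j * N) * mean c L < w x}"
  proof (rule emeasure_mono)
    have "(2::real) ^ (?j * N) * mean c L \<le> 2 ^ m * 1"
      using le1 mean_pos[OF L, of c] by (intro mult_mono power_increasing) auto
    then show "?S \<subseteq> {x \<in> cub c L. 2 ^ (?j * N) * mean c L < w x}" by auto
    show "{x \<in> cub c L. 2 ^ (?j * N) * mean c L < w x} \<in> sets \<mu>" by measurable
  qed
  also have "\<dots> \<le> ennreal ((1 / 2) ^ ?j) * emeasure \<mu> (cub c L)" by (rule decay[OF N L])
  also have "\<dots> \<le> ennreal ((1 / 2) ^ ?j) * emeasure lebesgue (cub c L)"
    using le1 L mean_pos[OF L, of c]
    by (intro mult_left_mono) (simp_all only: emeasure_mu_cub emeasure_cub less_imp_le, simp_all add: ennreal_leI)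
  finally have "ennreal ((1 / 2) ^ m) * (ennreal (2 ^ m) * emeasure lebesgue ?S)
      \<le> ennreal ((1 / 2) ^ m) * (ennreal ((1 / 2) ^ ?j) * emeasure lebesgue (cub c L))"
    by (rule mult_left_mono) simp
  moreover have "ennreal ((1 / 2) ^ m) * ennreal (2 ^ m) = 1"
    by (subst ennreal_mult[symmetric]) (auto simp: power_one_over)
  moreover have "ennreal ((1 / 2) ^ m) * ennreal ((1 / 2) ^ ?j) = ennreal ((1 / 2) ^ m * (1 / 2) ^ ?j)"
    by (subst ennreal_mult) auto
  ultimately show ?thesis by (simp only: mult.assoc[symmetric] mult_1_left)
qed

section \<open>Invertibility and measurability of matrix-valued functions\<close>

lemma matrix_vector_mult_smult: "A *v (c *s x) = c *s (A *v x)" for A :: "complex ^ 'n ^ 'm"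
  by (rule vec.linear_scale[OF matrix_vector_mul_linear_gen])

lemma locally_integrable_measurable:
  assumes "locally_integrable g"
  shows "g \<in> borel_measurable lebesgue"
proof (rule borel_measurable_LIMSEQ_metric)
  fix n :: nat
  have "set_integrable lebesgue (cball 0 (real n)) g"
    using assms by (simp add: locally_integrable_def)
  then show "(\<lambda>x. indicator (cball 0 (real n)) x *\<^sub>R g x) \<in> borel_measurable lebesgue"
    unfolding set_integrable_def by (rule borel_measurable_integrable)
next
  fix x
  have "eventually (\<lambda>n. indicator (cball 0 (real n)) x *\<^sub>R g x = g x) sequentially"
    using eventually_ge_at_top[of "nat \<lceil>norm x\<rceil>"]
    by eventually_elim (simp add: nat_ceiling_le_eq)
  then show "(\<lambda>n. indicator (cball 0 (real n)) x *\<^sub>R g x) \<longlonglongrightarrow> g x"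
    by (rule tendsto_eventually)
qed

lemma positive_definite_nz:
  assumes "positive_definite A" "e \<noteq> 0"
  shows "A *v e \<noteq> 0"
  using assms unfolding positive_definite_def by fastforce

lemma positive_definite_invertible:
  fixes A :: "complex ^ 'n ^ 'n"
  assumes "positive_definite A"
  shows "invertible A"
proof -
  have "inj ((*v) A)"
    using positive_definite_nz[OF assms] matrix_left_invertible_ker[of A]
    by (metis matrix_left_invertible_injective)
  then show ?thesis by (simp add: invertible_left_inverse matrix_left_invertible_injective)
qed

text \<open>No candidate satisfies the defining predicate, so the choice operator returns one fixed
  value on all singular matrices. Measurability of the inverse then reduces to a case split on the
  determinant.\<close>

lemma matrix_inv_singular:
  fixes A :: "complex ^ 'n ^ 'n"
  assumes "det A = 0"
  shows "matrix_inv A = (SOME A'. False)"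
proof -
  have "\<not> invertible A" using assms by (simp add: invertible_det_nz)
  then have "(\<lambda>A'. A ** A' = mat 1 \<and> A' ** A = mat 1) = (\<lambda>A'. False)"
    by (auto simp: invertible_def fun_eq_iff)
  then show ?thesis by (simp add: matrix_inv_def)
qed

text \<open>Cramer's rule for the columns of the identity; the formula makes measurability of the
  inverse visible.\<close>

lemma matrix_inv_nth:
  fixes A :: "complex ^ 'n ^ 'n"
  assumes "det A \<noteq> 0"
  shows "matrix_inv A $ i $ j = det (\<chi> r c. if c = i then axis j 1 $ r else A $ r $ c) / det A"
proof -
  have "A *v (matrix_inv A *v axis j 1) = axis j 1"
    using matrix_inv_right[of A] assms by (simp add: matrix_vector_mul_assoc invertible_det_nz)
  then have "matrix_inv A *v axis j 1 = (\<chi> k. det (\<chi> r c. if c = k then axis j 1 $ r else A $ r $ c) / det A)"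
    using cramer[OF assms] by blast
  then have "(matrix_inv A *v axis j 1) $ i = det (\<chi> r c. if c = i then axis j 1 $ r else A $ r $ c) / det A"
    by simp
  moreover have "(matrix_inv A *v axis j 1) $ i = matrix_inv A $ i $ j"
    by (simp add: matrix_vector_mult_def axis_def if_distrib cong: if_cong)
  ultimately show ?thesis by simp
qed

lemma borel_measurable_det:
  fixes A :: "'x \<Rightarrow> complex ^ 'n ^ 'n"
  assumes [measurable]: "\<And>i j. (\<lambda>x. A x $ i $ j) \<in> borel_measurable M"
  shows "(\<lambda>x. det (A x)) \<in> borel_measurable M"
  unfolding det_def by measurable

lemma borel_measurable_matrix_inv:
  fixes A :: "'x \<Rightarrow> complex ^ 'n ^ 'n"
  assumes A [measurable]: "\<And>i j. (\<lambda>x. A x $ i $ j) \<in> borel_measurable M"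
  shows "(\<lambda>x. matrix_inv (A x) $ i $ j) \<in> borel_measurable M"
proof -
  have [measurable]: "(\<lambda>x. det (A x)) \<in> borel_measurable M" by (rule borel_measurable_det[OF A])
  have [measurable]: "(\<lambda>x. det (\<chi> r c. if c = i then axis j 1 $ r else A x $ r $ c)) \<in> borel_measurable M"
    by (rule borel_measurable_det) (auto intro: A)
  have "(\<lambda>x. matrix_inv (A x) $ i $ j) = (\<lambda>x. if det (A x) = 0 then (SOME A'. False) $ i $ j
      else det (\<chi> r c. if c = i then axis j 1 $ r else A x $ r $ c) / det (A x))"
    by (auto simp: matrix_inv_nth matrix_inv_singular)
  also have "\<dots> \<in> borel_measurable M" by measurable
  finally show ?thesis .
qed

lemma borel_measurable_matrix_vector_mult_nth:
  fixes A :: "'x \<Rightarrow> complex ^ 'n ^ 'm"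
  assumes [measurable]: "\<And>i j. (\<lambda>x. A x $ i $ j) \<in> borel_measurable M"
    "\<And>i. (\<lambda>x. v x $ i) \<in> borel_measurable M"
  shows "(\<lambda>x. (A x *v v x) $ i) \<in> borel_measurable M"
  unfolding matrix_vector_mult_def vec_lambda_beta by measurable

lemma borel_measurable_norm_vec:
  fixes v :: "'x \<Rightarrow> complex ^ 'n"
  assumes [measurable]: "\<And>i. (\<lambda>x. v x $ i) \<in> borel_measurable M"
  shows "(\<lambda>x. norm (v x)) \<in> borel_measurable M"
  unfolding norm_vec_def L2_set_def by measurable

lemma nn_integral_cub_positive:
  assumes "u \<in> borel_measurable lebesgue" "AE x in lebesgue. 0 < u x" "0 < L"
  shows "0 < (\<integral>\<^sup>+ x\<in>cub c L. ennreal (u x) \<partial>lebesgue)"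
proof (rule ccontr)
  have [measurable]: "u \<in> borel_measurable lebesgue" by fact
  assume "\<not> 0 < (\<integral>\<^sup>+ x\<in>cub c L. ennreal (u x) \<partial>lebesgue)"
  then have "(\<integral>\<^sup>+ x\<in>cub c L. ennreal (u x) \<partial>lebesgue) = 0" by (simp add: not_gr_zero)
  then have "AE x in lebesgue. ennreal (u x) * indicator (cub c L) x = 0"
    by (subst (asm) nn_integral_0_iff_AE) auto
  then have "AE x in lebesgue. x \<notin> cub c L"
    using assms(2) by eventually_elim (auto simp: indicator_def split: if_splits)
  then have "emeasure lebesgue (cub c L) = 0"
    by (subst (asm) AE_iff_measurable[of "cub c L"]) auto
  then show False using emeasure_cub[of L c] assms(3) by simp
qed

section \<open>Reducing norms and the pointwise form of the A1 condition\<close>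

locale A1_weight =
  fixes W :: "real ^ 'd \<Rightarrow> complex ^ 'n ^ 'n" and a :: real
  assumes W: "matrix_weight W" and A1_le: "A1_const W \<le> ennreal a" and a_nonneg: "0 \<le> a"
begin

lemma W_meas [measurable]: "(\<lambda>x. W x $ i $ j) \<in> borel_measurable lebesgue"
  using W locally_integrable_measurable unfolding matrix_weight_def by blast

lemma norm_W_meas [measurable]: "(\<lambda>x. norm (W x *v e)) \<in> borel_measurable lebesgue"
  by (intro borel_measurable_norm_vec borel_measurable_matrix_vector_mult_nth) auto

lemma AE_positive_definite: "AE x in lebesgue. positive_definite (W x)"
  using W by (simp add: matrix_weight_def)

lemma norm_W_finite: "(\<integral>\<^sup>+ x\<in>cub c L. ennreal (norm (W x *v e)) \<partial>lebesgue) < \<infinity>"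
proof -
  have int: "integrable lebesgue (\<lambda>x. \<Sum>i\<in>UNIV. \<Sum>j\<in>UNIV. norm (indicator (cub c L) x *\<^sub>R W x $ i $ j) * norm (e $ j))"
  proof (intro Bochner_Integration.integrable_sum integrable_mult_left integrable_norm)
    fix i j :: 'n
    have "compact (cub c L)" by (simp add: cub_def)
    then show "integrable lebesgue (\<lambda>x. indicator (cub c L) x *\<^sub>R W x $ i $ j)"
      using W by (simp add: matrix_weight_def locally_integrable_def set_integrable_def)
  qed
  have "norm (W x *v e) * indicator (cub c L) x \<le>
      (\<Sum>i\<in>UNIV. \<Sum>j\<in>UNIV. norm (indicator (cub c L) x *\<^sub>R W x $ i $ j) * norm (e $ j))" for x
  proof (cases "x \<in> cub c L")
    case True
    have "norm (W x *v e) \<le> (\<Sum>i\<in>UNIV. norm ((W x *v e) $ i))"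
      unfolding norm_vec_def by (rule L2_set_le_sum) simp
    also have "\<dots> \<le> (\<Sum>i\<in>UNIV. \<Sum>j\<in>UNIV. norm (W x $ i $ j * e $ j))"
      unfolding matrix_vector_mult_def vec_lambda_beta by (intro sum_mono norm_sum)
    finally show ?thesis using True by (simp add: norm_mult)
  qed (simp add: sum_nonneg)
  then have "(\<integral>\<^sup>+ x. ennreal (norm (W x *v e) * indicator (cub c L) x) \<partial>lebesgue) \<le>
      (\<integral>\<^sup>+ x. ennreal (\<Sum>i\<in>UNIV. \<Sum>j\<in>UNIV. norm (indicator (cub c L) x *\<^sub>R W x $ i $ j) * norm (e $ j)) \<partial>lebesgue)"
    by (intro nn_integral_mono ennreal_leI)
  also have "\<dots> < \<infinity>"
    using nn_integral_eq_integral[OF int] by (simp add: sum_nonneg)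
  finally show ?thesis by (simp add: ennreal_mult' ennreal_indicator)
qed

lemma norm_W_pos:
  assumes "e \<noteq> 0" "0 < L"
  shows "0 < (\<integral>\<^sup>+ x\<in>cub c L. ennreal (norm (W x *v e)) \<partial>lebesgue)"
proof (rule nn_integral_cub_positive)
  show "AE x in lebesgue. 0 < norm (W x *v e)"
    using AE_positive_definite by eventually_elim (use assms(1) positive_definite_nz in auto)
qed (auto simp: assms)

text \<open>The reducing norm of the cube, a norm on vectors when \<open>0 < L\<close>;
  \<open>enn2real\<close> loses nothing because the integral is finite.\<close>

definition \<rho> :: "real ^ 'd \<Rightarrow> real \<Rightarrow> complex ^ 'n \<Rightarrow> real" where
  "\<rho> c L e = enn2real (\<integral>\<^sup>+ x\<in>cub c L. ennreal (norm (W x *v e)) \<partial>lebesgue) / L ^ CARD('d)"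

lemma ennreal_rho:
  assumes "0 < L"
  shows "(\<integral>\<^sup>+ x\<in>cub c L. ennreal (norm (W x *v e)) \<partial>lebesgue) = ennreal (\<rho> c L e * L ^ CARD('d))"
  using norm_W_finite[of e c L] assms by (simp add: \<rho>_def)

lemma rho_nonneg: "0 < L \<Longrightarrow> 0 \<le> \<rho> c L e"
  by (simp add: \<rho>_def)

lemma rho_smult:
  assumes L: "0 < L"
  shows "\<rho> c L (k *s x) = norm k * \<rho> c L x"
proof -
  have "ennreal (\<rho> c L (k *s x) * L ^ CARD('d)) =
      (\<integral>\<^sup>+ z. ennreal (norm k) * (ennreal (norm (W z *v x)) * indicator (cub c L) z) \<partial>lebesgue)"
    unfolding ennreal_rho[OF L, symmetric]
    by (intro nn_integral_cong) (simp add: matrix_vector_mult_smult norm_smult_vec ennreal_mult mult.assoc)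
  also have "\<dots> = ennreal (norm k) * ennreal (\<rho> c L x * L ^ CARD('d))"
    unfolding ennreal_rho[OF L, symmetric] by (intro nn_integral_cmult) auto
  finally have "\<rho> c L (k *s x) * L ^ CARD('d) = (norm k * \<rho> c L x) * L ^ CARD('d)"
    using rho_nonneg[OF L] L by (simp add: mult.assoc flip: ennreal_mult)
  then show ?thesis using L by simp
qed

lemma rho_pos:
  assumes "e \<noteq> 0" and L: "0 < L"
  shows "0 < \<rho> c L e"
proof -
  have "0 < ennreal (\<rho> c L e * L ^ CARD('d))"
    unfolding ennreal_rho[OF L, symmetric] by (rule norm_W_pos[OF assms])
  then show ?thesis using L by (simp add: ennreal_less_zero_iff zero_less_mult_iff)
qed

lemma rho_triangle:
  assumes L: "0 < L"
  shows "\<rho> c L (x + y) \<le> \<rho> c L x + \<rho> c L y"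
proof -
  have "ennreal (\<rho> c L (x + y) * L ^ CARD('d)) \<le>
      (\<integral>\<^sup>+ z. ennreal (norm (W z *v x)) * indicator (cub c L) z + ennreal (norm (W z *v y)) * indicator (cub c L) z \<partial>lebesgue)"
    unfolding ennreal_rho[OF L, symmetric]
    by (intro nn_integral_mono)
      (auto split: split_indicator simp: matrix_vector_right_distrib norm_triangle_ineq simp flip: ennreal_plus)
  also have "\<dots> = ennreal (\<rho> c L x * L ^ CARD('d)) + ennreal (\<rho> c L y * L ^ CARD('d))"
    unfolding ennreal_rho[OF L, symmetric] by (intro nn_integral_add) auto
  finally have "\<rho> c L (x + y) * L ^ CARD('d) \<le> (\<rho> c L x + \<rho> c L y) * L ^ CARD('d)"
    using rho_nonneg[OF L] L by (simp add: distrib_right flip: ennreal_plus)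
  then show ?thesis using L by simp
qed

lemma reducing_basis:
  assumes L: "0 < L"
  obtains E :: "'n \<Rightarrow> complex ^ 'n" where "\<And>i. \<rho> c L (E i) \<le> 1" "\<And>i. E i \<noteq> 0"
    "\<And>A x. norm (A *v x) \<le> \<rho> c L x * (\<Sum>i\<in>UNIV. norm ((A :: complex ^ 'n ^ 'n) *v E i))"
  using norm_basis_exists[of "\<rho> c L", OF rho_nonneg[OF L] rho_triangle[OF L] rho_smult[OF L] rho_pos[OF _ L]]
  by metis

text \<open>The A1 condition at a point, tested on vectors and over all cubes through it at once, so
  that a single null set serves every cube.\<close>

definition good :: "real ^ 'd \<Rightarrow> bool" where
  "good y \<longleftrightarrow> (\<forall>c L. 0 < L \<longrightarrow> y \<in> cub c L \<longrightarrow> (\<forall>v. \<rho> c L (matrix_inv (W y) *v v) \<le> a * norm v))"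

text \<open>The essential supremum bounds the inner supremum almost everywhere, and the operator
  norm bounds the action on each unit vector; averaging over \<open>z\<close> and scaling do the
  rest.\<close>

lemma AE_good: "AE y in lebesgue. good y"
proof -
  have "AE y in lebesgue. (SUP Q\<in>{Q. cube Q \<and> y \<in> Q}.
     avg Q (\<lambda>z. ennreal (onorm (\<lambda>e. (W z ** matrix_inv (W y)) *v e)))) \<le> A1_const W"
    unfolding A1_const_def by (rule esssup_AE)
  then show ?thesis
  proof eventually_elim
    case (elim y)
    show "good y" unfolding good_def
    proof (intro allI impI)
      fix c L v assume L: "0 < L" and y: "y \<in> cub c L"
      let ?on = "\<lambda>z. ennreal (onorm (\<lambda>e. (W z ** matrix_inv (W y)) *v e))"
      have "avg (cub c L) ?on \<le> (SUP Q\<in>{Q. cube Q \<and> y \<in> Q}. avg Q ?on)"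
        using y L by (intro SUP_upper) (auto intro: cube_cub)
      then have "avg (cub c L) ?on \<le> ennreal a" using elim A1_le by (meson order_trans)
      then have on: "(\<integral>\<^sup>+ z\<in>cub c L. ?on z \<partial>lebesgue) \<le> ennreal a * ennreal (L ^ CARD('d))"
        using L unfolding avg_def emeasure_cub[OF less_imp_le[OF L]]
        by (intro ennreal_le_mult_of_divide_le) auto
      have unit: "\<rho> c L (matrix_inv (W y) *v u) \<le> a" if "norm u = 1" for u
      proof -
        have "norm (W z *v (matrix_inv (W y) *v u)) \<le> onorm (\<lambda>e. (W z ** matrix_inv (W y)) *v e)" for z
          using onorm[OF matrix_vector_mul_bounded_linear, of "W z ** matrix_inv (W y)" u] that
          by (simp add: matrix_vector_mul_assoc)
        then have "(\<integral>\<^sup>+ z\<in>cub c L. ennreal (norm (W z *v (matrix_inv (W y) *v u))) \<partial>lebesgue)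
            \<le> (\<integral>\<^sup>+ z\<in>cub c L. ?on z \<partial>lebesgue)"
          by (intro nn_integral_mono mult_right_mono ennreal_leI) auto
        also note on
        finally have "ennreal (\<rho> c L (matrix_inv (W y) *v u) * L ^ CARD('d)) \<le> ennreal (a * L ^ CARD('d))"
          using L a_nonneg by (simp add: ennreal_rho ennreal_mult)
        then show ?thesis using L a_nonneg by (simp add: zero_le_mult_iff)
      qed
      show "\<rho> c L (matrix_inv (W y) *v v) \<le> a * norm v"
      proof (cases "v = 0")
        case True
        then show ?thesis using rho_smult[OF L, of c 0 0] by simp
      next
        case False
        define k where "k = complex_of_real (inverse (norm v))"
        have k: "norm k = inverse (norm v)" by (simp only: k_def norm_of_real) simp
        have "norm (k *s v) = 1" using False by (simp add: norm_smult_vec k)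
        then have "inverse (norm v) * \<rho> c L (matrix_inv (W y) *v v) \<le> a"
          using unit[of "k *s v"] by (simp add: matrix_vector_mult_smult rho_smult[OF L] k)
        then show ?thesis using False by (simp add: field_simps)
      qed
    qed
  qed
qed

text \<open>Thresholds below divide by \<open>a\<close>. Some \<open>y\<close> is good with
  \<open>W y\<close> positive definite, and there a positive reducing norm is bounded by a multiple
  of \<open>a\<close>.\<close>

lemma a_pos: "0 < a"
proof -
  have "AE y in lebesgue. good y \<and> positive_definite (W y)"
    using AE_good AE_positive_definite by (rule AE_conjI)
  then have "\<exists>y. good y \<and> positive_definite (W y)"
  proof (rule contrapos_pp)
    assume "\<nexists>y. good y \<and> positive_definite (W y)"
    then have "{y \<in> space lebesgue. \<not> (good y \<and> positive_definite (W y))} = UNIV" by auto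
    then show "\<not> (AE y in lebesgue. good y \<and> positive_definite (W y))"
      by (subst AE_iff_measurable[of UNIV]) auto
  qed
  then obtain y where y: "good y" "positive_definite (W y)" by blast
  define v :: "complex ^ 'n" where "v = axis undefined 1"
  have "v \<noteq> 0" by (simp add: v_def axis_eq_0_iff)
  have "W y *v (matrix_inv (W y) *v v) = v"
    using matrix_inv_right[OF positive_definite_invertible[OF y(2)]] by (simp add: matrix_vector_mul_assoc)
  then have "matrix_inv (W y) *v v \<noteq> 0" using \<open>v \<noteq> 0\<close> by auto
  then have "0 < \<rho> y 1 (matrix_inv (W y) *v v)" by (intro rho_pos) auto
  also have "\<dots> \<le> a * norm v" using y(1) corner_in_cub[of 1 y] unfolding good_def by simp
  finally show ?thesis using a_nonneg by (simp add: zero_less_mult_iff)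
qed

lemma ainfty_weight:
  assumes "e \<noteq> 0" "Ainfty_sc_const W \<le> ennreal B" "0 \<le> B"
  shows "ainfty_weight (\<lambda>x. norm (W x *v e)) B"
proof
  have "Ainfty_const (\<lambda>x. norm (W x *v e)) \<le> Ainfty_sc_const W"
    unfolding Ainfty_sc_const_def using assms(1) by (intro SUP_upper) auto
  then show "Ainfty_const (\<lambda>x. norm (W x *v e)) \<le> ennreal B" using assms(2) by (rule order_trans)
qed (use assms norm_W_finite norm_W_pos in auto)

lemma mean_eq_rho:
  assumes "ainfty_weight (\<lambda>x. norm (W x *v e)) B"
  shows "ainfty_weight.mean (\<lambda>x. norm (W x *v e)) c L = \<rho> c L e"
proof -
  interpret ainfty_weight "\<lambda>x. norm (W x *v e)" B by fact
  show ?thesis by (simp add: mean_def \<rho>_def measure_def emeasure_mu)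
qed

text \<open>The basis is that of a large cube \<open>cub c L\<close>, whereas the average is over an arbitrary subcube: no
  comparison of the reducing norms of different cubes, which would cost another factor \<open>a\<close>, is needed.\<close>

lemma avg_le:
  assumes f: "f \<in> borel_measurable lebesgue" and L: "0 < L" and s: "0 < s"
    and sub: "cub b s \<subseteq> cub c L"
    and E: "\<And>A x. norm (A *v x) \<le> \<rho> c L x * (\<Sum>i\<in>UNIV. norm ((A :: complex ^ 'n ^ 'n) *v E i))"
  shows "avg (cub b s) (\<lambda>y. ennreal (norm ((W x ** matrix_inv (W y)) *v f y))) \<le>
    ennreal (a * (\<Sum>i\<in>UNIV. norm (W x *v E i))) * avg (cub b s) (\<lambda>y. ennreal (norm (f y)))"
proof -
  let ?S = "\<Sum>i\<in>UNIV. norm (W x *v E i)"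
  have S: "0 \<le> ?S" by (intro sum_nonneg) simp
  have "AE y in lebesgue. ennreal (norm ((W x ** matrix_inv (W y)) *v f y)) * indicator (cub b s) y \<le>
      ennreal (a * ?S) * (ennreal (norm (f y)) * indicator (cub b s) y)"
    using AE_good
  proof eventually_elim
    case (elim y)
    show ?case
    proof (cases "y \<in> cub b s")
      case True
      then have "\<rho> c L (matrix_inv (W y) *v f y) \<le> a * norm (f y)"
        using elim sub L unfolding good_def by blast
      then have "norm (W x *v (matrix_inv (W y) *v f y)) \<le> (a * norm (f y)) * ?S"
        using E[of "W x" "matrix_inv (W y) *v f y"] S by (meson mult_right_mono order_trans)
      then have "norm ((W x ** matrix_inv (W y)) *v f y) \<le> (a * ?S) * norm (f y)"
        by (simp add: matrix_vector_mul_assoc mult_ac)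
      then have "ennreal (norm ((W x ** matrix_inv (W y)) *v f y)) \<le> ennreal ((a * ?S) * norm (f y))"
        by (rule ennreal_leI)
      also have "\<dots> = ennreal (a * ?S) * ennreal (norm (f y))" using a_nonneg S by (intro ennreal_mult) auto
      finally show ?thesis using True by simp
    qed simp
  qed
  then have "(\<integral>\<^sup>+ y\<in>cub b s. ennreal (norm ((W x ** matrix_inv (W y)) *v f y)) \<partial>lebesgue) \<le>
      (\<integral>\<^sup>+ y. ennreal (a * ?S) * (ennreal (norm (f y)) * indicator (cub b s) y) \<partial>lebesgue)"
    by (rule nn_integral_mono_AE)
  also have "\<dots> = ennreal (a * ?S) * (\<integral>\<^sup>+ y\<in>cub b s. ennreal (norm (f y)) \<partial>lebesgue)"
    using f by (intro nn_integral_cmult) auto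
  finally show ?thesis unfolding avg_def ennreal_times_divide by (rule divide_right_mono_ennreal)
qed

end

subsection \<open>The weak type inequality\<close>

lemma sigma_finite_lebesgue: "sigma_finite_measure (lebesgue :: 'a::euclidean_space measure)"
proof
  have "\<Union> (range (\<lambda>n::nat. cball (0::'a) (real n))) = UNIV"
    by (auto simp: real_arch_simple)
  then show "\<exists>A. countable A \<and> A \<subseteq> sets (lebesgue :: 'a measure) \<and>
      \<Union> A = space lebesgue \<and> (\<forall>a\<in>A. emeasure lebesgue a \<noteq> \<infinity>)"
    using emeasure_lborel_cball_finite[of "0::'a"]
    by (intro exI[of _ "range (\<lambda>n::nat. cball (0::'a) (real n))"]) (auto simp: less_top)
qed

text \<open>The terms form blocks of \<open>N\<close> equal powers, and the block values are a
  geometric series with sum two. The single factor \<open>N\<close>, hence the linear dependence on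
  the Fujii--Wilson constant, arises here.\<close>

lemma suminf_half_power_div:
  assumes "0 < N"
  shows "(\<Sum>m. ennreal ((1 / 2) ^ (m div N))) \<le> ennreal (2 * real N)"
  unfolding suminf_eq_SUP
proof (rule SUP_least)
  fix n
  have "(\<Sum>m<n. ennreal ((1 / 2) ^ (m div N))) = ennreal (\<Sum>m<n. (1 / 2) ^ (m div N))"
    by (rule sum_ennreal) simp
  also have "\<dots> \<le> ennreal (2 * real N)"
  proof (rule ennreal_leI)
    have "n * 1 \<le> n * N" using assms by (intro mult_le_mono2) auto
    then have "(\<Sum>m<n. (1 / 2 :: real) ^ (m div N)) \<le> (\<Sum>m<n * N. (1 / 2) ^ (m div N))"
      by (intro sum_mono2) auto
    also have "\<dots> = (\<Sum>j<n. \<Sum>m\<in>{j * N..<j * N + N}. (1 / 2) ^ (m div N))"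
      by (rule sum.nat_group[symmetric])
    also have "\<dots> = (\<Sum>j<n. \<Sum>m\<in>{j * N..<j * N + N}. (1 / 2) ^ j)"
    proof (intro sum.cong refl)
      fix j m assume "m \<in> {j * N..<j * N + N}"
      then have "m div N = j" by (intro div_nat_eqI) (auto simp: mult.commute)
      then show "(1 / 2 :: real) ^ (m div N) = (1 / 2) ^ j" by simp
    qed
    also have "\<dots> = real N * (\<Sum>j<n. (1 / 2) ^ j)" by (simp add: sum_distrib_left)
    also have "\<dots> \<le> real N * 2"
      unfolding sum_gp_strict by (intro mult_left_mono) auto
    finally show "(\<Sum>m<n. (1 / 2 :: real) ^ (m div N)) \<le> 2 * real N" by simp
  qed
  finally show "(\<Sum>m<n. ennreal ((1 / 2) ^ (m div N))) \<le> ennreal (2 * real N)" .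
qed

lemma less_avg_cub_iff:
  fixes g :: "real ^ 'd \<Rightarrow> ennreal"
  assumes r: "0 < r" and l: "0 \<le> l"
  shows "ennreal l < avg (cub c r) g \<longleftrightarrow> ennreal (l * r ^ CARD('d)) < (\<integral>\<^sup>+ y\<in>cub c r. g y \<partial>lebesgue)"
proof -
  let ?I = "\<integral>\<^sup>+ y\<in>cub c r. g y \<partial>lebesgue" and ?V = "ennreal (r ^ CARD('d))"
  have V: "?V \<noteq> 0" "?V \<noteq> top" using r by auto
  have "avg (cub c r) g = ?I / ?V" using r unfolding avg_def by (simp only: emeasure_cub less_imp_le)
  moreover have "?I / ?V \<le> ennreal l \<longleftrightarrow> ?I \<le> ennreal l * ?V"
  proof
    assume "?I / ?V \<le> ennreal l"
    then show "?I \<le> ennreal l * ?V" using V by (rule ennreal_le_mult_of_divide_le)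
  next
    assume "?I \<le> ennreal l * ?V"
    then have "?I / ?V \<le> ennreal l * ?V / ?V" by (rule divide_right_mono_ennreal)
    then show "?I / ?V \<le> ennreal l" using V by (simp add: mult_divide_eq_ennreal)
  qed
  moreover have "ennreal l * ?V = ennreal (l * r ^ CARD('d))" using l r by (simp add: ennreal_mult)
  ultimately show ?thesis by (simp add: not_le[symmetric])
qed

text \<open>Makes the supremum over cubes countable, whence measurability of superlevel sets.\<close>

lemma rational_cube:
  fixes g :: "real ^ 'd \<Rightarrow> ennreal"
  assumes r: "0 < r" and l: "0 \<le> l" and less: "ennreal l < avg (cub c r) g"
  obtains q :: "'d \<Rightarrow> rat" and s :: rat where "0 < s"
    "cub c r \<subseteq> cub (\<chi> i. of_rat (q i)) (of_rat s)"
    "ennreal l < avg (cub (\<chi> i. of_rat (q i)) (of_rat s)) g"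
proof -
  let ?I = "\<integral>\<^sup>+ y\<in>cub c r. g y \<partial>lebesgue"
  have I: "ennreal (l * r ^ CARD('d)) < ?I" using less by (simp add: less_avg_cub_iff[OF r l])
  \<comment> \<open>Enlarging the side by \<open>2 * \<eta>\<close> keeps the strict inequality for
    small \<open>\<eta>\<close> and leaves room for a rational corner and side.\<close>
  have "((\<lambda>\<eta>. ennreal (l * (r + 2 * \<eta>) ^ CARD('d))) \<longlongrightarrow> ennreal (l * (r + 2 * 0) ^ CARD('d))) (at_right 0)"
    by (intro tendsto_ennrealI tendsto_intros)
  then have "eventually (\<lambda>\<eta>. ennreal (l * (r + 2 * \<eta>) ^ CARD('d)) < ?I) (at_right 0)"
    using I by (intro order_tendstoD(2)) auto
  then have "eventually (\<lambda>\<eta>. ennreal (l * (r + 2 * \<eta>) ^ CARD('d)) < ?I \<and> 0 < \<eta>) (at_right 0)"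
    by (intro eventually_conj eventually_at_right_less)
  then obtain \<eta> where \<eta>: "ennreal (l * (r + 2 * \<eta>) ^ CARD('d)) < ?I" "0 < \<eta>"
    using eventually_happens'[OF trivial_limit_at_right_real] by blast
  have "\<forall>i. \<exists>q. c $ i - \<eta> < of_rat q \<and> of_rat q < c $ i"
    using \<eta>(2) by (intro allI of_rat_dense) simp
  then obtain q where q: "\<And>i. c $ i - \<eta> < of_rat (q i) \<and> of_rat (q i) < c $ i" by metis
  obtain s where s: "r + \<eta> < of_rat s" "of_rat s < r + 2 * \<eta>"
    using of_rat_dense[of "r + \<eta>" "r + 2 * \<eta>"] \<eta>(2) by auto
  have s0: "0 < (of_rat s :: real)" using s(1) r \<eta>(2) by linarith
  have sub: "cub c r \<subseteq> cub (\<chi> i. of_rat (q i)) (of_rat s)"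
  proof -
    have "of_rat (q i) \<le> c $ i \<and> c $ i + r \<le> of_rat (q i) + of_rat s" for i
      using q[of i] s by linarith
    then show ?thesis using r by (subst cub_subset_iff) auto
  qed
  have "ennreal (l * of_rat s ^ CARD('d)) \<le> ennreal (l * (r + 2 * \<eta>) ^ CARD('d))"
    using s s0 l by (intro ennreal_leI mult_left_mono power_mono) auto
  also have "\<dots> < ?I" by (rule \<eta>(1))
  also have "\<dots> \<le> (\<integral>\<^sup>+ y\<in>cub (\<chi> i. of_rat (q i)) (of_rat s). g y \<partial>lebesgue)"
    using sub by (intro nn_integral_mono) (auto split: split_indicator)
  finally show ?thesis using that[of s q] s0 sub by (simp add: less_avg_cub_iff[OF s0 l])
qed

section \<open>Superlevel sets of the weighted maximal function\<close>

context A1_weight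
begin

text \<open>For a fixed cube the average is measurable in \<open>x\<close> by Tonelli, and
  \<open>rational_cube\<close> replaces the union over all cubes by a countable one.\<close>

lemma superlevel_sets:
  assumes f: "f \<in> borel_measurable lebesgue" and l: "0 < l"
  shows "{x. weighted_maximal W f x > ennreal l} \<in> sets lebesgue"
proof -
  define h where "h y = matrix_inv (W y) *v f y" for y
  have "(\<lambda>y. f y $ i) \<in> borel_measurable lebesgue" for i
    by (rule measurable_compose[OF f]) (intro borel_measurable_continuous_onI continuous_intros)
  then have h: "(\<lambda>y. h y $ i) \<in> borel_measurable lebesgue" for i
    unfolding h_def by (intro borel_measurable_matrix_vector_mult_nth borel_measurable_matrix_inv W_meas)
  define G where "G c r x = avg (cub c r) (\<lambda>y. ennreal (norm ((W x ** matrix_inv (W y)) *v f y)))" for c r x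
  have G: "G c r \<in> borel_measurable lebesgue" for c r
  proof -
    have [measurable]: "(\<lambda>p. norm (W (fst p) *v h (snd p))) \<in> borel_measurable (lebesgue \<Otimes>\<^sub>M lebesgue)"
      by (intro borel_measurable_norm_vec borel_measurable_matrix_vector_mult_nth
          measurable_compose[OF measurable_fst W_meas] measurable_compose[OF measurable_snd h])
    have "(\<lambda>x. \<integral>\<^sup>+ y. ennreal (norm (W x *v h y)) * indicator (cub c r) y \<partial>lebesgue) \<in> borel_measurable lebesgue"
      by (intro sigma_finite_measure.borel_measurable_nn_integral[OF sigma_finite_lebesgue])
        (simp add: case_prod_beta)
    then show ?thesis
      unfolding G_def[abs_def] avg_def h_def by (simp add: matrix_vector_mul_assoc)
  qed
  let ?c = "\<lambda>q :: 'd \<Rightarrow> rat. (\<chi> i. of_rat (q i)) :: real ^ 'd"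
  have "{x. weighted_maximal W f x > ennreal l} =
      (\<Union>(q, s)\<in>{(q, s). 0 < s}. {x \<in> cub (?c q) (of_rat s). ennreal l < G (?c q) (of_rat s) x})"
  proof (intro equalityI subsetI)
    fix x assume "x \<in> {x. weighted_maximal W f x > ennreal l}"
    then obtain c r where c: "0 < r" "x \<in> cub c r" "ennreal l < G c r x"
      unfolding weighted_maximal_def G_def by (auto simp: less_SUP_iff cube_iff_cub)
    obtain q s where "0 < s" "cub c r \<subseteq> cub (?c q) (of_rat s)"
      "ennreal l < avg (cub (?c q) (of_rat s)) (\<lambda>y. ennreal (norm ((W x ** matrix_inv (W y)) *v f y)))"
      by (rule rational_cube[OF c(1) less_imp_le[OF l] c(3)[unfolded G_def]]; rule that; assumption)
    then show "x \<in> (\<Union>(q, s)\<in>{(q, s). 0 < s}. {x \<in> cub (?c q) (of_rat s). ennreal l < G (?c q) (of_rat s) x})"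
      using c(2) unfolding G_def[symmetric] by blast
  next
    fix x assume "x \<in> (\<Union>(q, s)\<in>{(q, s). 0 < s}. {x \<in> cub (?c q) (of_rat s). ennreal l < G (?c q) (of_rat s) x})"
    then obtain q s where qs: "0 < s" "x \<in> cub (?c q) (of_rat s)" "ennreal l < G (?c q) (of_rat s) x" by auto
    have "G (?c q) (of_rat s) x \<le> weighted_maximal W f x"
      unfolding weighted_maximal_def G_def using qs by (intro SUP_upper) (auto intro: cube_cub)
    then show "x \<in> {x. weighted_maximal W f x > ennreal l}" using qs(3) by auto
  qed
  moreover have "(case p of (q, s) \<Rightarrow> {x \<in> cub (?c q) (of_rat s). ennreal l < G (?c q) (of_rat s) x}) \<in> sets lebesgue"
    for p :: "('d \<Rightarrow> rat) \<times> rat"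
  proof -
    have [measurable]: "G c r \<in> borel_measurable lebesgue" for c r by (rule G)
    show ?thesis unfolding case_prod_beta by measurable
  qed
  ultimately show ?thesis
    using sets.countable_UN'[of "{(q :: 'd \<Rightarrow> rat, s :: rat). 0 < s}" _ lebesgue] by auto
qed

lemma weak_type_bound:
  fixes f :: "real ^ 'd \<Rightarrow> complex ^ 'n"
  defines "n \<equiv> real CARD('n)" and "d \<equiv> CARD('d)"
  assumes f: "f \<in> borel_measurable lebesgue" and l: "0 < l"
    and \<phi>: "(\<integral>\<^sup>+ x. ennreal (norm (f x)) \<partial>lebesgue) = ennreal \<phi>" "0 \<le> \<phi>"
    and B: "Ainfty_sc_const W \<le> ennreal B" "0 \<le> B"
  shows "emeasure lebesgue {x. weighted_maximal W f x > ennreal l} \<le>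
    ennreal (5 ^ d * n * (1 + 20 * n * 5 ^ d) * (a * B / l) * \<phi>)"
proof -
  have n: "0 < n" by (simp add: n_def)
  have B1: "1 \<le> B"
  proof -
    have "(axis undefined 1 :: complex ^ 'n) \<noteq> 0" by (simp add: axis_eq_0_iff)
    then interpret ainfty_weight "\<lambda>x. norm (W x *v axis undefined 1)" B
      using ainfty_weight B by blast
    show ?thesis by (rule one_le_B)
  qed
  \<comment> \<open>The least \<open>N\<close> allowed in \<open>decay\<close>; as
    \<open>1 \<le> B\<close>, rounding up costs only a constant factor.\<close>
  define N where "N = nat \<lceil>4 * 5 ^ d * B\<rceil>"
  have "0 < 4 * 5 ^ d * B" using B1 by simp
  then have N: "0 < N" "4 * 5 ^ d * B \<le> real N" "real N \<le> 4 * 5 ^ d * B + 1"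
    unfolding N_def by (linarith+)
  have "1 * 1 \<le> 5 ^ d * B" using B1 by (intro mult_mono) auto
  then have N_le: "real N \<le> 5 * 5 ^ d * B" using N(3) by linarith
  \<comment> \<open>With this \<open>T\<close>, an average of \<open>norm f\<close> at most
    \<open>T / 2 ^ m\<close> forces the sum over the basis above \<open>n * 2 ^ m\<close>, hence one
    of its terms above \<open>2 ^ m\<close>.\<close>
  define T where "T = l / (a * n)"
  have T: "0 < T" using l a_pos n by (simp add: T_def)
  define F where "F p = (\<integral>\<^sup>+ y\<in>cub (fst p) (snd p). ennreal (norm (f y)) \<partial>lebesgue)" for p :: "(real ^ 'd) \<times> real"
  define \<alpha> where "\<alpha> p = avg (cub (fst p) (snd p)) (\<lambda>y. ennreal (norm (f y)))" for p :: "(real ^ 'd) \<times> real"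
  have F_le: "F p \<le> ennreal \<phi>" for p
    unfolding F_def \<phi>(1)[symmetric] by (intro nn_integral_mono) (auto split: split_indicator)
  have \<alpha>_gt: "ennreal (t * snd p ^ d) < F p" if "0 < snd p" "0 \<le> t" "ennreal t < \<alpha> p" for t p
    using that unfolding \<alpha>_def F_def d_def by (simp add: less_avg_cub_iff)
  \<comment> \<open>Cubes sorted by the size of the average of \<open>norm f\<close>; class \<open>0\<close> collects all large averages.\<close>
  define I where "I k = {p. 0 < snd p \<and> ennreal (T / 2 ^ k) < \<alpha> p \<and> (k = 0 \<or> \<alpha> p \<le> ennreal (2 * T / 2 ^ k))}" for k :: nat
  have "\<exists>J. J \<subseteq> I k \<and> countable J \<and> disjoint_family_on (\<lambda>(a, r). cub a r) J \<and>
      (\<forall>a r. (a, r) \<in> I k \<longrightarrow> (\<exists>(b, s)\<in>J. \<not> disjnt (cub a r) (cub b s) \<and> r \<le> 2 * s))" for k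
  proof -
    \<comment> \<open>Vitali selection needs bounded sides. The integral over the cube is at most
      \<open>\<phi>\<close>, which bounds \<open>r ^ d\<close>, and \<open>r \<le> 1 + r ^ d\<close>
      avoids taking roots.\<close>
    have size: "0 < r \<and> r \<le> 1 + \<phi> / (T / 2 ^ k)" if "(b, r) \<in> I k" for b r
    proof -
      have r: "0 < r" and "ennreal (T / 2 ^ k) < \<alpha> (b, r)" using that by (auto simp: I_def)
      then have "ennreal (T / 2 ^ k * r ^ d) < F (b, r)" using \<alpha>_gt[of "(b, r)" "T / 2 ^ k"] T by simp
      also have "\<dots> \<le> ennreal \<phi>" by (rule F_le)
      finally have "T / 2 ^ k * r ^ d \<le> \<phi>" using T r \<phi>(2) by (simp add: ennreal_less_iff)
      then have "r ^ d \<le> \<phi> / (T / 2 ^ k)" using T by (simp add: field_simps)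
      moreover have "r \<le> 1 + r ^ d"
      proof (cases "r \<le> 1")
        case True
        then show ?thesis using r by (simp add: add_increasing2)
      next
        case False
        then have "r ^ 1 \<le> r ^ d" by (intro power_increasing) (auto simp: d_def Suc_le_eq)
        then show ?thesis by simp
      qed
      ultimately show ?thesis using r by linarith
    qed
    show ?thesis
      by (rule vitali_cubes[of "I k" "1 + \<phi> / (T / 2 ^ k)"]; (rule size; assumption)?) blast
  qed
  from choice[OF allI, OF this] obtain J where J_all: "\<forall>k. J k \<subseteq> I k \<and> countable (J k) \<and>
      disjoint_family_on (\<lambda>(a, r). cub a r) (J k) \<and>
      (\<forall>a r. (a, r) \<in> I k \<longrightarrow> (\<exists>(b, s)\<in>J k. \<not> disjnt (cub a r) (cub b s) \<and> r \<le> 2 * s))" ..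
  then have J: "\<And>k. J k \<subseteq> I k" "\<And>k. countable (J k)"
      "\<And>k. disjoint_family_on (\<lambda>(a, r). cub a r) (J k)"
    and J_cover: "\<And>k a r. (a, r) \<in> I k \<Longrightarrow> \<exists>(b, s)\<in>J k. \<not> disjnt (cub a r) (cub b s) \<and> r \<le> 2 * s"
    by blast+
  have J_pos: "0 < snd p" if "p \<in> J k" for p k using J(1) that by (auto simp: I_def)
  define cc where "cc p = (\<chi> i. fst p $ i - 2 * snd p)" for p :: "(real ^ 'd) \<times> real"
  define Q where "Q p = cub (cc p) (5 * snd p)" for p
  have Q_sets: "Q p \<in> sets lebesgue" for p by (simp add: Q_def)
  have "\<exists>E :: 'n \<Rightarrow> complex ^ 'n. 0 < snd p \<longrightarrow> (\<forall>i. \<rho> (cc p) (5 * snd p) (E i) \<le> 1) \<and> (\<forall>i. E i \<noteq> 0) \<and>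
      (\<forall>A x. norm (A *v x) \<le> \<rho> (cc p) (5 * snd p) x * (\<Sum>i\<in>UNIV. norm ((A :: complex ^ 'n ^ 'n) *v E i)))" for p
  proof (cases "0 < snd p")
    case True
    then have s: "0 < 5 * snd p" by simp
    show ?thesis
    proof (rule reducing_basis[OF s, of "cc p"])
      fix E :: "'n \<Rightarrow> complex ^ 'n"
      assume "\<And>i. \<rho> (cc p) (5 * snd p) (E i) \<le> 1" "\<And>i. E i \<noteq> 0"
        "\<And>A x. norm (A *v x) \<le> \<rho> (cc p) (5 * snd p) x * (\<Sum>i\<in>UNIV. norm ((A :: complex ^ 'n ^ 'n) *v E i))"
      then show ?thesis by (intro exI[of _ E]) blast
    qed
  qed simp
  from choice[OF allI, OF this] obtain E :: "(real ^ 'd) \<times> real \<Rightarrow> 'n \<Rightarrow> complex ^ 'n"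
    where "\<forall>p. 0 < snd p \<longrightarrow> (\<forall>i. \<rho> (cc p) (5 * snd p) (E p i) \<le> 1) \<and> (\<forall>i. E p i \<noteq> 0) \<and>
      (\<forall>A x. norm (A *v x) \<le> \<rho> (cc p) (5 * snd p) x * (\<Sum>i\<in>UNIV. norm ((A :: complex ^ 'n ^ 'n) *v E p i)))" ..
  then have E: "\<And>p i. 0 < snd p \<Longrightarrow> \<rho> (cc p) (5 * snd p) (E p i) \<le> 1" "\<And>p i. 0 < snd p \<Longrightarrow> E p i \<noteq> 0"
      "\<And>p A x. 0 < snd p \<Longrightarrow> norm (A *v x) \<le> \<rho> (cc p) (5 * snd p) x * (\<Sum>i\<in>UNIV. norm ((A :: complex ^ 'n ^ 'n) *v E p i))"
    by blast+
  define D where "D m = (\<Union>p\<in>J (Suc m). \<Union>i. {x \<in> Q p. 2 ^ m < norm (W x *v E p i)})" for m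
  have bad_sets: "{x \<in> Q p. 2 ^ m < norm (W x *v E p i)} \<in> sets lebesgue" for p m i
    unfolding Q_def by measurable
  have D_sets: "D m \<in> sets lebesgue" for m
    unfolding D_def using J(2) bad_sets by (intro sets.countable_UN' sets.finite_UN) auto

  have cover: "{x. weighted_maximal W f x > ennreal l} \<subseteq> (\<Union>p\<in>J 0. Q p) \<union> (\<Union>m. D m)"
  proof
    fix x assume "x \<in> {x. weighted_maximal W f x > ennreal l}"
    then obtain b s where bs: "0 < s" "x \<in> cub b s"
      "ennreal l < avg (cub b s) (\<lambda>y. ennreal (norm ((W x ** matrix_inv (W y)) *v f y)))"
      unfolding weighted_maximal_def by (auto simp: less_SUP_iff cube_iff_cub)
    have upper: "ennreal l < ennreal (a * (\<Sum>i\<in>UNIV. norm (W x *v E p i))) * \<alpha> (b, s)"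
      if "0 < snd p" "cub b s \<subseteq> Q p" for p
      using bs(3) avg_le[OF f _ bs(1) that(2)[unfolded Q_def] E(3)[OF that(1)], of x] that(1)
      unfolding \<alpha>_def by (auto intro: less_le_trans)
    have "\<alpha> (b, s) \<noteq> top"
    proof -
      have "ennreal (s ^ d) \<noteq> 0" using bs(1) by simp
      then have "F (b, s) / ennreal (s ^ d) \<noteq> top"
        using F_le[of "(b, s)"] by (auto simp: ennreal_divide_eq_top_iff top_unique)
      then show ?thesis using bs(1) unfolding \<alpha>_def F_def avg_def d_def by (simp only: fst_conv snd_conv emeasure_cub less_imp_le) simp
    qed
    then obtain r where r: "0 \<le> r" "\<alpha> (b, s) = ennreal r" by (metis ennreal_cases)
    \<comment> \<open>Otherwise \<open>upper\<close>, used for the enlargement of the cube itself,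
      would give \<open>ennreal l < 0\<close>.\<close>
    have "\<alpha> (b, s) \<noteq> 0"
    proof
      assume "\<alpha> (b, s) = 0"
      have s2: "0 < snd (b, s)" using bs(1) by simp
      have "cub b s \<subseteq> Q (b, s)"
        unfolding Q_def cc_def using bs by (intro cub_subset_enlarged) (auto simp: disjnt_def)
      from upper[OF s2 this] show False using \<open>\<alpha> (b, s) = 0\<close> by simp
    qed
    then have r0: "0 < r" using r by (cases "r = 0") auto
    have ex: "\<exists>k. T / 2 ^ k < r"
    proof -
      obtain k where "T / r < 2 ^ k" using real_arch_pow[of 2 "T / r"] by auto
      then show ?thesis using r0 by (auto simp: field_simps)
    qed
    \<comment> \<open>Minimality of \<open>k\<close> places the average between
      \<open>T / 2 ^ k\<close> and twice that, except for \<open>k = 0\<close>, where no upper bound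
      is available.\<close>
    define k where "k = (LEAST k. T / 2 ^ k < r)"
    have k: "T / 2 ^ k < r" unfolding k_def by (rule LeastI_ex[OF ex])
    have k': "r \<le> 2 * T / 2 ^ k" if "k \<noteq> 0"
    proof -
      obtain m where m: "k = Suc m" using \<open>k \<noteq> 0\<close> by (cases k) auto
      then have "\<not> T / 2 ^ m < r" using not_less_Least[of m "\<lambda>k. T / 2 ^ k < r"] by (simp add: k_def)
      then show ?thesis by (simp add: m)
    qed
    have "(b, s) \<in> I k"
      using bs(1) r k k' T by (auto simp: I_def ennreal_less_iff intro!: ennreal_leI)
    then obtain p where p: "p \<in> J k" "\<not> disjnt (cub b s) (cub (fst p) (snd p))" "s \<le> 2 * snd p"
      using J_cover[of b s k] by force
    have sub: "cub b s \<subseteq> Q p" unfolding Q_def cc_def by (rule cub_subset_enlarged[OF p(2,3)])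
    show "x \<in> (\<Union>p\<in>J 0. Q p) \<union> (\<Union>m. D m)"
    \<comment> \<open>Class \<open>0\<close> needs no information on \<open>W\<close>: its enlarged
      cubes are included whole.\<close>
    proof (cases k)
      case 0
      then show ?thesis using p(1) sub bs(2) by blast
    next
      case (Suc m)
      let ?S = "\<Sum>i\<in>UNIV. norm (W x *v E p i)"
      have S: "0 \<le> ?S" by (intro sum_nonneg) simp
      have "ennreal l < ennreal (a * ?S) * ennreal r"
        using upper[OF J_pos[OF p(1)] sub] by (simp only: r(2))
      then have "l < a * ?S * r"
        using S a_nonneg r(1) l by (simp add: ennreal_less_iff flip: ennreal_mult)
      also have "\<dots> \<le> a * ?S * (T / 2 ^ m)" using k' Suc S a_nonneg by (intro mult_left_mono) auto
      also have "\<dots> = l * (?S / (n * 2 ^ m))" using a_pos n by (simp add: T_def field_simps)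
      finally have "l * 1 < l * (?S / (n * 2 ^ m))" by simp
      then have "1 < ?S / (n * 2 ^ m)" using l by (simp only: mult_less_cancel_left_pos)
      then have big: "n * 2 ^ m < ?S" using n by (simp add: field_simps)
      have "\<exists>i. 2 ^ m < norm (W x *v E p i)"
      proof (rule ccontr)
        assume "\<nexists>i. 2 ^ m < norm (W x *v E p i)"
        then have "?S \<le> of_nat (card (UNIV :: 'n set)) * 2 ^ m" by (intro sum_bounded_above) (auto simp: not_less)
        then show False using big by (simp add: n_def)
      qed
      then have "x \<in> D m" using p(1) Suc sub bs(2) unfolding D_def by blast
      then show ?thesis by blast
    qed
  qed

  \<comment> \<open>Selected cubes of class \<open>k\<close> have measure at most
    \<open>2 ^ k / T\<close> times the integral of \<open>norm f\<close> over them. Disjointness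
    sums these integrals to at most \<open>\<phi>\<close>, and enlarging costs
    \<open>5 ^ d\<close>.\<close>
  have K: "(\<integral>\<^sup>+ p. emeasure lebesgue (Q p) \<partial>count_space (J k)) \<le> ennreal (5 ^ d * (2 ^ k / T) * \<phi>)" for k
  proof -
    define \<nu> where "\<nu> = density lebesgue (\<lambda>x. ennreal (norm (f x)))"
    have \<nu>: "emeasure \<nu> A = (\<integral>\<^sup>+ x\<in>A. ennreal (norm (f x)) \<partial>lebesgue)" if "A \<in> sets lebesgue" for A
      unfolding \<nu>_def using f that by (intro emeasure_density) auto
    have one: "emeasure lebesgue (Q p) \<le> ennreal (5 ^ d * (2 ^ k / T)) * emeasure \<nu> (cub (fst p) (snd p))"
      if p: "p \<in> J k" for p
    proof -
      have s: "0 < snd p" by (rule J_pos[OF p])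
      have "ennreal (T / 2 ^ k * snd p ^ d) \<le> emeasure \<nu> (cub (fst p) (snd p))"
        using \<alpha>_gt[OF s, of "T / 2 ^ k"] T J(1) p by (auto simp: I_def F_def \<nu> intro: less_imp_le)
      then have "ennreal (5 ^ d * (2 ^ k / T)) * ennreal (T / 2 ^ k * snd p ^ d) \<le>
          ennreal (5 ^ d * (2 ^ k / T)) * emeasure \<nu> (cub (fst p) (snd p))"
        by (rule mult_left_mono) simp
      also have "ennreal (5 ^ d * (2 ^ k / T)) * ennreal (T / 2 ^ k * snd p ^ d) =
          ennreal (5 ^ d * (2 ^ k / T) * (T / 2 ^ k * snd p ^ d))"
        using T s by (intro ennreal_mult[symmetric]) auto
      also have "5 ^ d * (2 ^ k / T) * (T / 2 ^ k * snd p ^ d) = (5 * snd p) ^ d"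
        using T by (simp add: power_mult_distrib)
      also have "ennreal ((5 * snd p) ^ d) = emeasure lebesgue (Q p)"
        unfolding Q_def d_def using s by (intro emeasure_cub[symmetric]) simp
      finally show ?thesis .
    qed
    have "(\<integral>\<^sup>+ p. emeasure lebesgue (Q p) \<partial>count_space (J k)) \<le>
        (\<integral>\<^sup>+ p. ennreal (5 ^ d * (2 ^ k / T)) * emeasure \<nu> (cub (fst p) (snd p)) \<partial>count_space (J k))"
      by (intro nn_integral_mono one) simp
    also have "\<dots> = ennreal (5 ^ d * (2 ^ k / T)) * (\<integral>\<^sup>+ p. emeasure \<nu> (cub (fst p) (snd p)) \<partial>count_space (J k))"
      by (rule nn_integral_cmult) simp
    also have "(\<integral>\<^sup>+ p. emeasure \<nu> (cub (fst p) (snd p)) \<partial>count_space (J k)) =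
        emeasure \<nu> (\<Union>p\<in>J k. cub (fst p) (snd p))"
    proof -
      have eq: "(\<lambda>p. cub (fst p) (snd p)) = (\<lambda>(a :: real ^ 'd, r). cub a r)" by auto
      show ?thesis
        using J(2,3) unfolding eq[symmetric]
        by (intro emeasure_UN_countable[symmetric]) (auto simp: \<nu>_def)
    qed
    also have "\<dots> \<le> ennreal \<phi>"
    proof -
      have "emeasure \<nu> (\<Union>p\<in>J k. cub (fst p) (snd p)) \<le> emeasure \<nu> UNIV"
        by (intro emeasure_mono) (auto simp: \<nu>_def)
      also have "\<dots> = ennreal \<phi>" using \<phi>(1) by (simp add: \<nu>)
      finally show ?thesis .
    qed
    finally have "(\<integral>\<^sup>+ p. emeasure lebesgue (Q p) \<partial>count_space (J k)) \<le> ennreal (5 ^ d * (2 ^ k / T)) * ennreal \<phi>"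
      by (simp add: mult_left_mono)
    also have "\<dots> = ennreal (5 ^ d * (2 ^ k / T) * \<phi>)"
      using T \<phi>(2) by (intro ennreal_mult[symmetric]) auto
    finally show ?thesis .
  qed

  define c1 where "c1 = 2 * n * 5 ^ d * \<phi> / T"
  have c1: "0 \<le> c1" using n T \<phi>(2) by (simp add: c1_def)
  \<comment> \<open>The growth \<open>2 ^ Suc m\<close> in \<open>K\<close> is cancelled, up to a
    factor two, by the Chebyshev factor of \<open>lebesgue_decay\<close>, which leaves the summable
    \<open>(1 / 2) ^ (m div N)\<close>.\<close>
  have D_le: "emeasure lebesgue (D m) \<le> ennreal c1 * ennreal ((1 / 2) ^ (m div N))" for m
  proof -
    let ?\<delta> = "(1 / 2 :: real) ^ m * (1 / 2) ^ (m div N)"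
    have one: "emeasure lebesgue (\<Union>i. {x \<in> Q p. 2 ^ m < norm (W x *v E p i)}) \<le> ennreal (n * ?\<delta>) * emeasure lebesgue (Q p)"
      if p: "p \<in> J (Suc m)" for p
    proof -
      have s: "0 < snd p" by (rule J_pos[OF p])
      have each: "emeasure lebesgue {x \<in> Q p. 2 ^ m < norm (W x *v E p i)} \<le> ennreal ?\<delta> * emeasure lebesgue (Q p)" for i
      proof -
        have aw: "ainfty_weight (\<lambda>x. norm (W x *v E p i)) B" by (rule ainfty_weight[OF E(2)[OF s] B])
        interpret ainfty_weight "\<lambda>x. norm (W x *v E p i)" B by (rule aw)
        have "mean (cc p) (5 * snd p) \<le> 1" using E(1)[OF s, of i] by (simp add: mean_eq_rho[OF aw])
        then show ?thesis
          unfolding Q_def using lebesgue_decay[OF N(1), of "5 * snd p" "cc p" m] N(2) s by (simp add: d_def)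
      qed
      have "emeasure lebesgue (\<Union>i. {x \<in> Q p. 2 ^ m < norm (W x *v E p i)}) \<le>
          (\<Sum>i\<in>UNIV. emeasure lebesgue {x \<in> Q p. 2 ^ m < norm (W x *v E p i)})"
        by (intro emeasure_subadditive_finite image_subsetI bad_sets finite)
      also have "\<dots> \<le> of_nat (card (UNIV :: 'n set)) * (ennreal ?\<delta> * emeasure lebesgue (Q p))"
        by (intro sum_bounded_above each)
      also have "\<dots> = ennreal (n * ?\<delta>) * emeasure lebesgue (Q p)"
        using n by (simp only: n_def ennreal_of_nat_eq_real_of_nat mult.assoc[symmetric])
          (subst ennreal_mult[symmetric], auto simp: mult.assoc)
      finally show ?thesis .
    qed
    have "emeasure lebesgue (D m) \<le> (\<integral>\<^sup>+ p. emeasure lebesgue (\<Union>i. {x \<in> Q p. 2 ^ m < norm (W x *v E p i)}) \<partial>count_space (J (Suc m)))"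
      unfolding D_def using J(2) bad_sets by (intro emeasure_UN_le_count_space sets.finite_UN) auto
    also have "\<dots> \<le> (\<integral>\<^sup>+ p. ennreal (n * ?\<delta>) * emeasure lebesgue (Q p) \<partial>count_space (J (Suc m)))"
      by (intro nn_integral_mono one) simp
    also have "\<dots> = ennreal (n * ?\<delta>) * (\<integral>\<^sup>+ p. emeasure lebesgue (Q p) \<partial>count_space (J (Suc m)))"
      by (rule nn_integral_cmult) simp
    also have "\<dots> \<le> ennreal (n * ?\<delta>) * ennreal (5 ^ d * (2 ^ Suc m / T) * \<phi>)"
      by (intro mult_left_mono K) simp
    also have "\<dots> = ennreal (n * ?\<delta> * (5 ^ d * (2 ^ Suc m / T) * \<phi>))"
      using n T \<phi>(2) by (intro ennreal_mult[symmetric]) auto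
    also have "n * ?\<delta> * (5 ^ d * (2 ^ Suc m / T) * \<phi>) = c1 * (1 / 2) ^ (m div N) * ((1 / 2) ^ m * 2 ^ m)"
      by (simp add: c1_def mult_ac)
    also have "(1 / 2 :: real) ^ m * 2 ^ m = 1" by (simp add: power_one_over)
    finally show ?thesis using c1 by (simp add: ennreal_mult)
  qed
  have "emeasure lebesgue {x. weighted_maximal W f x > ennreal l} \<le>
      emeasure lebesgue ((\<Union>p\<in>J 0. Q p) \<union> (\<Union>m. D m))"
    using cover J(2) Q_sets D_sets by (intro emeasure_mono sets.Un sets.countable_UN') auto
  also have "\<dots> \<le> emeasure lebesgue (\<Union>p\<in>J 0. Q p) + emeasure lebesgue (\<Union>m. D m)"
    using J(2) Q_sets D_sets by (intro emeasure_subadditive sets.countable_UN') auto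
  also have "\<dots> \<le> ennreal (5 ^ d * (2 ^ 0 / T) * \<phi>) + ennreal c1 * ennreal (2 * real N)"
  proof (rule add_mono)
    show "emeasure lebesgue (\<Union>p\<in>J 0. Q p) \<le> ennreal (5 ^ d * (2 ^ 0 / T) * \<phi>)"
      using J(2) Q_sets by (intro order_trans[OF emeasure_UN_le_count_space K]) auto
    have "emeasure lebesgue (\<Union>m. D m) \<le> (\<Sum>m. emeasure lebesgue (D m))"
      using D_sets by (intro emeasure_subadditive_countably) auto
    also have "\<dots> \<le> (\<Sum>m. ennreal c1 * ennreal ((1 / 2) ^ (m div N)))"
      by (intro suminf_le D_le) auto
    also have "\<dots> = ennreal c1 * (\<Sum>m. ennreal ((1 / 2) ^ (m div N)))" by (rule ennreal_suminf_cmult)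
    also have "\<dots> \<le> ennreal c1 * ennreal (2 * real N)"
      by (intro mult_left_mono suminf_half_power_div N(1)) simp
    finally show "emeasure lebesgue (\<Union>m. D m) \<le> ennreal c1 * ennreal (2 * real N)" .
  qed
  also have "\<dots> = ennreal (5 ^ d * (2 ^ 0 / T) * \<phi> + c1 * (2 * real N))"
    using T \<phi>(2) c1 by (simp add: ennreal_mult ennreal_plus)
  also have "\<dots> \<le> ennreal (5 ^ d * n * (1 + 20 * n * 5 ^ d) * (a * B / l) * \<phi>)"
  proof (rule ennreal_leI)
    have "5 ^ d * (2 ^ 0 / T) * \<phi> + c1 * (2 * real N) = 5 ^ d * n * (a / l) * \<phi> * (1 + 4 * n * real N)"
      using l a_pos n by (simp add: T_def c1_def field_simps)
    \<comment> \<open>\<open>real N \<le> 5 * 5 ^ d * B\<close> produces the \<open>20\<close>, and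
      \<open>1 \<le> B\<close> absorbs the additive one.\<close>
    also have "\<dots> \<le> 5 ^ d * n * (a / l) * \<phi> * ((1 + 20 * n * 5 ^ d) * B)"
    proof (rule mult_left_mono)
      have "4 * n * real N \<le> 4 * n * (5 * 5 ^ d * B)" using N_le n by (intro mult_left_mono) auto
      then show "1 + 4 * n * real N \<le> (1 + 20 * n * 5 ^ d) * B" using B1 by (simp add: algebra_simps)
    qed (use n a_pos l \<phi>(2) in auto)
    finally show "5 ^ d * (2 ^ 0 / T) * \<phi> + c1 * (2 * real N) \<le>
        5 ^ d * n * (1 + 20 * n * 5 ^ d) * (a * B / l) * \<phi>" by (simp add: mult_ac)
  qed
  finally show ?thesis .
qed

end

theorem theorem1p1:
  shows "\<exists>C::real. 0 < C \<and>
    (\<forall>W :: real ^ 'd \<Rightarrow> complex ^ 'n ^ 'n. matrix_weight W \<and> A1_const W < \<infinity> \<longrightarrow>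
      (\<forall>f :: real ^ 'd \<Rightarrow> complex ^ 'n. \<forall>l::real. integrable lebesgue f \<and> 0 < l \<longrightarrow>
        {x. weighted_maximal W f x > ennreal l} \<in> sets lebesgue \<and>
        emeasure lebesgue {x. weighted_maximal W f x > ennreal l} \<le>
          ennreal C * (A1_const W * Ainfty_sc_const W / ennreal l) *
          (\<integral>\<^sup>+ x. ennreal (norm (f x)) \<partial>lebesgue)))"
proof -
  define C :: real where "C = 5 ^ CARD('d) * real CARD('n) * (1 + 20 * real CARD('n) * 5 ^ CARD('d))"
  have C: "0 < C" unfolding C_def by (intro mult_pos_pos add_pos_nonneg) auto
  show ?thesis
  proof (intro exI[of _ C] conjI allI impI C)
    fix W :: "real ^ 'd \<Rightarrow> complex ^ 'n ^ 'n" and f :: "real ^ 'd \<Rightarrow> complex ^ 'n" and l :: real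
    assume W: "matrix_weight W \<and> A1_const W < \<infinity>" and fl: "integrable lebesgue f \<and> 0 < l"
    have f: "f \<in> borel_measurable lebesgue" and l: "0 < l" using fl by auto
    obtain a where a: "0 \<le> a" "A1_const W = ennreal a"
      using W by (metis ennreal_cases infinity_ennreal_def less_irrefl)
    interpret A1_weight W a by unfold_locales (use W a in auto)
    show "{x. weighted_maximal W f x > ennreal l} \<in> sets lebesgue"
      by (rule superlevel_sets[OF f l])
    obtain \<phi> where \<phi>: "0 \<le> \<phi>" "(\<integral>\<^sup>+ x. ennreal (norm (f x)) \<partial>lebesgue) = ennreal \<phi>"
      using fl by (metis integrable_iff_bounded ennreal_cases infinity_ennreal_def less_irrefl)
    show "emeasure lebesgue {x. weighted_maximal W f x > ennreal l} \<le>
          ennreal C * (A1_const W * Ainfty_sc_const W / ennreal l) *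
          (\<integral>\<^sup>+ x. ennreal (norm (f x)) \<partial>lebesgue)"
    proof (cases "Ainfty_sc_const W = top")
      case False
      then obtain B where B: "0 \<le> B" "Ainfty_sc_const W = ennreal B" by (metis ennreal_cases)
      have "emeasure lebesgue {x. weighted_maximal W f x > ennreal l} \<le> ennreal (C * (a * B / l) * \<phi>)"
        using weak_type_bound[OF f l \<phi>(2,1), of B] B by (simp add: C_def)
      also have "\<dots> = ennreal C * ennreal (a * B / l) * ennreal \<phi>"
        using C a B l \<phi>(1) by (simp flip: ennreal_mult)
      also have "ennreal (a * B / l) = A1_const W * Ainfty_sc_const W / ennreal l"
        using a B l by (simp add: divide_ennreal flip: ennreal_mult)
      finally show ?thesis by (simp add: \<phi>(2))
    next
      case True
      \<comment> \<open>With an infinite scalar constant the right-hand side is infinite unless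
        \<open>f\<close> vanishes almost everywhere. Then it is zero, since zero times infinity is
        zero in \<open>ennreal\<close>, and the superlevel set is empty.\<close>
      show ?thesis
      proof (cases "\<phi> = 0")
        case False
        then have "ennreal C * (A1_const W * Ainfty_sc_const W / ennreal l) *
          (\<integral>\<^sup>+ x. ennreal (norm (f x)) \<partial>lebesgue) = top"
          using C a_pos \<phi> l by (simp add: True a(2) ennreal_mult_top ennreal_top_mult ennreal_top_divide)
        then show ?thesis by simp
      next
        case True
        then have "(\<integral>\<^sup>+ x. ennreal (norm (f x)) \<partial>lebesgue) = 0" using \<phi>(2) by simp
        then have "AE x in lebesgue. ennreal (norm (f x)) = 0"
          using f by (subst (asm) nn_integral_0_iff_AE) auto
        then have "AE x in lebesgue. f x = 0" by eventually_elim simp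
        then have "(\<integral>\<^sup>+ y\<in>Q. ennreal (norm ((W x ** matrix_inv (W y)) *v f y)) \<partial>lebesgue) = 0" for x Q
          by (subst nn_integral_cong_AE[of _ "\<lambda>_. 0"]) (auto elim: eventually_mono)
        then have "weighted_maximal W f x \<le> 0" for x
          unfolding weighted_maximal_def avg_def by (intro SUP_least) simp
        then show ?thesis by simp
      qed
    qed
  qed
qed

end
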